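(* There is no regular Steinhaus graph of odd degree on $n$ vertices for any $n$ with $2<n\leq 1500$.
   Context: A Steinhaus matrix of size $n\geq1$ is a matrix $M=(a_{i,j})_{1\leq i,j\leq n}$ with entries in $\mathbb{F}_2=\{0,1\}$ such that $a_{i,i}=0$ for all $i$, $a_{i,j}=a_{i-1,j-1}+a_{i-1,j}$ (addition in $\mathbb{F}_2$) for all $2\leq i<j\leq n$, and $a_{i,j}=a_{j,i}$ for all $i,j$. A Steinhaus graph is a simple graph on labelled vertices $V_1,\ldots,V_n$ whose adjacency matrix is a Steinhaus matrix. *)

theory Defs
  imports "Graph_Theory.Pair_Digraph" "HOL-Library.Z2"
begin

text \<open>
  A square matrix of size \<open>n\<close> over the two-element field is a function with
  rows and columns numbered from 1; entries outside \<open>{1..n}\<close> play no role.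
\<close>

definition steinhaus_matrix :: "nat \<Rightarrow> (nat \<Rightarrow> nat \<Rightarrow> bit) \<Rightarrow> bool" where
  "steinhaus_matrix n a \<longleftrightarrow> n \<ge> 1
    \<and> (\<forall>i\<in>{1..n}. a i i = 0)
    \<and> (\<forall>i j. 2 \<le> i \<and> i < j \<and> j \<le> n \<longrightarrow> a i j = a (i - 1) (j - 1) + a (i - 1) j)
    \<and> (\<forall>i\<in>{1..n}. \<forall>j\<in>{1..n}. a i j = a j i)"

text \<open>
  The locale \<^locale>\<open>pair_graph\<close> describes finite simple graphs: an undirected edge
  between \<open>u\<close> and \<open>v\<close> is represented by the two arcs \<open>(u, v)\<close> and \<open>(v, u)\<close>.
\<close>

definition adjacency_matrix :: "'a pair_pre_digraph \<Rightarrow> 'a \<Rightarrow> 'a \<Rightarrow> bit" where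
  "adjacency_matrix G u v = (if (u, v) \<in> parcs G then 1 else 0)"

definition steinhaus_graph :: "nat \<Rightarrow> nat pair_pre_digraph \<Rightarrow> bool" where
  "steinhaus_graph n G \<longleftrightarrow>
     pair_graph G \<and> pverts G = {1..n} \<and> steinhaus_matrix n (adjacency_matrix G)"

text \<open>
  Each edge at \<open>v\<close> contributes exactly one arc leaving \<open>v\<close>, so the degree of \<open>v\<close> in a
  simple graph is its out-degree.
\<close>

definition regular_of_degree :: "'a pair_pre_digraph \<Rightarrow> nat \<Rightarrow> bool" where
  "regular_of_degree G d \<longleftrightarrow> (\<forall>v\<in>pverts G. out_degree (with_proj G) v = d)"

end

theory Submission
  imports Defs
begin

text \<open>
  Let \<open>a\<close> be the Steinhaus matrix of a graph on \<open>n\<close> vertices that is regular of odd degree \<open>d\<close>.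
  Telescoping the row sums modulo 2 shows that the antidiagonal of \<open>a\<close> vanishes except for its
  corners, so the matrix \<open>t\<close> with rows and columns \<open>2, \<dots>, n - 1\<close> of \<open>a\<close> is symmetric about its
  antidiagonal; comparing the degrees of opposite vertices then makes every row of the upper
  triangle of \<open>t\<close> a palindrome, and also gives \<open>n = 2 * d\<close>. Hence the row weights of the triangle
  are even, the degrees modulo 4 become linear conditions, and by telescoping once more they say
  that \<open>4 dvd d - 1\<close> and that, in each even row of the triangle, the two entries in the middle agree with the second entry.

  With \<open>M = d - 2\<close>, the triangle is determined by its middle entries \<open>y 0, \<dots>, y (M - 1)\<close>, listed
  upwards from the apex. The entry next to the end of a row is a sum of binomial coefficients times
  entries of \<open>y\<close>, so the condition on the even rows becomes a linear system for \<open>y\<close> whose first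
  equations do not depend on \<open>M\<close>. If \<open>y 1 = \<dots> = y J = 0\<close>, the symmetries force \<open>y\<close> to vanish near
  \<open>M - 1\<close> and, looking at the middle of the first rows, also near \<open>M div 2\<close>. Since the system has
  few solutions with such a gap, this enlarges \<open>J\<close>; for \<open>M \<le> 747\<close> finitely many eliminations,
  each serving a whole range of \<open>M\<close>, give \<open>y = 0\<close>. Then \<open>t = 0\<close>, which contradicts regularity.
\<close>

section \<open>Column elimination over the two-element field\<close>

declare add_bit_eq_xor [simp del] mult_bit_eq_and [simp del]

lemma bit_add_self [simp]: "x + x = 0" and bit_add_left_cancel [simp]: "x + (x + y) = y" for x y :: bit
  by (cases x; cases y; simp)+

lemma bit_add_eq_0_iff: "x + y = 0 \<longleftrightarrow> x = y" for x y :: bit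
  by (cases x; cases y; simp)

fun xor_list :: "bool list \<Rightarrow> bool list \<Rightarrow> bool list" where
  "xor_list [] ys = []"
| "xor_list (x # xs) [] = []"
| "xor_list (False # xs) (y # ys) = y # xor_list xs ys"
| "xor_list (True # xs) (False # ys) = True # xor_list xs ys"
| "xor_list (True # xs) (True # ys) = False # xor_list xs ys"

text \<open>
  Prefix sums turn the column of the binomial coefficients \<open>k + i choose k\<close> into the one
  for \<open>k + 1\<close>; the flag \<open>b\<close> is the entry in front of the list.
\<close>

fun prefix_sums :: "bool \<Rightarrow> bool list \<Rightarrow> bool list" where
  "prefix_sums b [] = []"
| "prefix_sums b (False # xs) = b # prefix_sums b xs"
| "prefix_sums False (True # xs) = True # prefix_sums True xs"
| "prefix_sums True (True # xs) = False # prefix_sums False xs"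

text \<open>
  A vector is a pair of a tag and the list of its entries in the rows not yet processed; the
  vectors are sorted by decreasing tag.
\<close>

fun add_pivot :: "bool list \<Rightarrow> (nat \<times> bool list) list \<Rightarrow> (nat \<times> bool list) list" where
  "add_pivot p [] = []"
| "add_pivot p ((t, []) # s) = (t, []) # add_pivot p s"
| "add_pivot p ((t, False # v) # s) = (t, v) # add_pivot p s"
| "add_pivot p ((t, True # v) # s) = (t, xor_list v p) # add_pivot p s"

text \<open>The first vector with entry 1 has the largest tag among those meeting the equation. It
  is the pivot and is dropped, since the equation expresses its unknown through the vectors behind
  it.\<close>

fun elim_row :: "(nat \<times> bool list) list \<Rightarrow> (nat \<times> bool list) list" where
  "elim_row [] = []"
| "elim_row ((t, []) # s) = (t, []) # elim_row s"
| "elim_row ((t, False # v) # s) = (t, v) # elim_row s"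
| "elim_row ((t, True # v) # s) = add_pivot v s"

text \<open>Equation \<open>j\<close> only involves unknowns below \<open>j\<close>, so column
  \<open>j\<close> joins right after that equation has been processed. The list \<open>c\<close>
  advances after even \<open>j\<close> only, because \<open>coef\<close> depends on
  \<open>(j - 1) div 2\<close>.\<close>

fun add_columns :: "nat \<Rightarrow> nat list \<Rightarrow> bool list \<Rightarrow> (nat \<times> bool list) list \<Rightarrow> (nat \<times> bool list) list" where
  "add_columns J [] c s = s"
| "add_columns J (j # js) c s = add_columns J js (if even j then prefix_sums True c else c)
     (if J < j then (j, c) # elim_row s else elim_row s)"

text \<open>
  Eliminates the columns of \<open>y (J + 1), \<dots>, y d\<close> through the equations \<open>1, \<dots>, h\<close>.
\<close>

definition eliminate :: "nat \<Rightarrow> nat \<Rightarrow> nat \<Rightarrow> (nat \<times> bool list) list" where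
  "eliminate J d h = (elim_row ^^ (h - d)) (add_columns J [1..<Suc d] (replicate h True) [])"

text \<open>
  \<open>coef i j\<close> is the coefficient of \<open>y j\<close> in equation \<open>i\<close>, for \<open>j \<le> i\<close>.
\<close>

definition coef :: "nat \<Rightarrow> nat \<Rightarrow> bit" where
  "coef i j = of_nat (((j - 1) div 2 + (i - j)) choose ((j - 1) div 2))"

lemma length_xor_list [simp]: "length (xor_list xs ys) = min (length xs) (length ys)"
  by (induction xs ys rule: xor_list.induct) auto

lemma nth_xor_list:
  "n < length xs \<Longrightarrow> n < length ys \<Longrightarrow> xor_list xs ys ! n \<longleftrightarrow> xs ! n \<noteq> ys ! n"
  by (induction xs ys arbitrary: n rule: xor_list.induct) (auto simp: nth_Cons split: nat.split)

lemma of_bool_neq_bit: "of_bool (P \<noteq> Q) = (of_bool P + of_bool Q :: bit)"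
  by auto

lemma length_prefix_sums [simp]: "length (prefix_sums b xs) = length xs"
  by (induction b xs rule: prefix_sums.induct) auto

lemma nth_prefix_sums_0: "xs \<noteq> [] \<Longrightarrow> of_bool (prefix_sums b xs ! 0) = (of_bool b + of_bool (xs ! 0) :: bit)"
  by (cases "(b, xs)" rule: prefix_sums.cases) auto

lemma nth_prefix_sums_Suc:
  "Suc n < length xs \<Longrightarrow>
    of_bool (prefix_sums b xs ! Suc n) = (of_bool (prefix_sums b xs ! n) + of_bool (xs ! Suc n) :: bit)"
proof (induction b xs arbitrary: n rule: prefix_sums.induct)
  case (2 b xs)
  then show ?case
    by (cases n) (auto simp: nth_prefix_sums_0)
next
  case (3 xs)
  then show ?case
    by (cases n) (auto simp: nth_prefix_sums_0)
next
  case (4 xs)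
  then show ?case
    by (cases n) (auto simp: nth_prefix_sums_0)
qed auto

text \<open>A column first matters in the equation after its own index, hence the offset
  \<open>Suc n\<close>.\<close>

definition binomial_column :: "nat \<Rightarrow> bool list \<Rightarrow> bool" where
  "binomial_column k c \<longleftrightarrow> (\<forall>n<length c. of_bool (c ! n) = (of_nat ((k + Suc n) choose k) :: bit))"

text \<open>Pascal's rule entry by entry; the flag \<open>True\<close> stands for
  \<open>k choose k = 1\<close>.\<close>

lemma binomial_column_prefix_sums:
  assumes "binomial_column k c"
  shows "binomial_column (Suc k) (prefix_sums True c)"
proof -
  have "of_bool (prefix_sums True c ! n) = (of_nat ((Suc k + Suc n) choose Suc k) :: bit)"
    if "n < length c" for n
    using that
  proof (induction n)
    case 0
    then have "of_bool (c ! 0) = (of_nat ((k + 1) choose k) :: bit)"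
      using assms by (auto simp: binomial_column_def)
    then show ?case
      using 0 by (auto simp: nth_prefix_sums_0 add.commute)
  next
    case (Suc n)
    then have "of_bool (c ! Suc n) = (of_nat ((k + Suc (Suc n)) choose k) :: bit)"
      using assms by (auto simp: binomial_column_def)
    then show ?case
      using Suc by (simp add: nth_prefix_sums_Suc add.commute)
  qed
  then show ?thesis
    by (simp add: binomial_column_def)
qed

definition combination :: "(nat \<Rightarrow> bit) \<Rightarrow> (nat \<times> bool list) list \<Rightarrow> nat \<Rightarrow> bit" where
  "combination y s n = (\<Sum>(t, v)\<leftarrow>s. y t * of_bool (v ! n))"

lemma combination_simps [simp]:
  "combination y [] n = 0"
  "combination y ((t, v) # s) n = y t * of_bool (v ! n) + combination y s n"
  by (simp_all add: combination_def)

lemma combination_eq_0: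
  "(\<And>t v. (t, v) \<in> set s \<Longrightarrow> y t * of_bool (v ! n) = 0) \<Longrightarrow> combination y s n = 0"
  by (induction s) fastforce+

text \<open>The pivot is added once for each vector with head 1, and the \<open>y\<close>-weighted
  sum of these heads is \<open>combination y s 0\<close>.\<close>

lemma combination_add_pivot:
  assumes "\<forall>(t, v)\<in>set s. Suc n < length v" "n < length p"
  shows "combination y (add_pivot p s) n = combination y s (Suc n) + of_bool (p ! n) * combination y s 0"
  using assms
  by (induction p s rule: add_pivot.induct) (simp_all add: nth_xor_list of_bool_neq_bit algebra_simps)

lemma fst_add_pivot [simp]: "map fst (add_pivot p s) = map fst s"
  by (induction p s rule: add_pivot.induct) auto

text \<open>In characteristic 2 the processed equation says that the unknown of the pivot equals the
  weighted sum of the heads behind it, which is the factor with which \<open>add_pivot\<close>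
  inserts the pivot.\<close>

lemma combination_elim_row:
  assumes "\<forall>(t, v)\<in>set s. Suc n < length v" "combination y s 0 = 0"
  shows "combination y (elim_row s) n = combination y s (Suc n)"
  using assms
proof (induction s rule: elim_row.induct)
  case (4 t v s)
  then have "y t = combination y s 0"
    by (simp add: bit_add_eq_0_iff)
  then show ?case
    using 4 by (simp add: combination_add_pivot mult.commute)
qed (auto simp: bit_add_eq_0_iff)

lemma set_elim_row_tags: "fst ` set (elim_row s) \<subseteq> fst ` set s"
proof (induction s rule: elim_row.induct)
  case (4 t v s)
  have "fst ` set (add_pivot v s) = fst ` set s"
    by (metis fst_add_pivot set_map)
  then show ?case by auto
qed auto

lemma sorted_elim_row:
  "sorted_wrt (>) (map fst s) \<Longrightarrow> sorted_wrt (>) (map fst (elim_row s))"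
  using set_elim_row_tags by (induction s rule: elim_row.induct) fastforce+

lemma length_add_pivot:
  assumes "\<forall>(t, v)\<in>set s. Suc n \<le> length v" "n \<le> length p"
  shows "\<forall>(t, v)\<in>set (add_pivot p s). n \<le> length v"
  using assms by (induction p s rule: add_pivot.induct) auto

lemma length_elim_row:
  assumes "\<forall>(t, v)\<in>set s. Suc n \<le> length v"
  shows "\<forall>(t, v)\<in>set (elim_row s). n \<le> length v"
  using assms
proof (induction s rule: elim_row.induct)
  case (4 t v s)
  then show ?case using length_add_pivot[of s n v] by simp
qed auto

text \<open>A pivot with tag at most \<open>T\<close> is determined by vectors of smaller tag, so
  vanishing passes back from the remaining variables to it.\<close>

lemma tags_elim_row:
  assumes "sorted_wrt (>) (map fst s)" "\<forall>(t, v)\<in>set s. v \<noteq> []" "combination y s 0 = 0"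
    and "\<forall>t\<in>fst ` set (elim_row s). t \<le> T \<longrightarrow> y t = 0"
  shows "\<forall>t\<in>fst ` set s. t \<le> T \<longrightarrow> y t = 0"
  using assms
proof (induction s rule: elim_row.induct)
  case (4 t v s)
  have tags: "fst ` set (add_pivot v s) = fst ` set s"
    by (metis fst_add_pivot set_map)
  have zero: "\<forall>t'\<in>fst ` set s. t' \<le> T \<longrightarrow> y t' = 0"
    using 4 tags by simp
  have "y t = 0" if "t \<le> T"
  proof -
    have "y t' * of_bool (w ! 0) = 0" if "(t', w) \<in> set s" for t' w
      using that zero 4(1) \<open>t \<le> T\<close> by force
    then have "combination y s 0 = 0"
      by (rule combination_eq_0)
    then show ?thesis using 4(3) by simp
  qed
  then show ?case using zero by simp
qed (auto simp: bit_add_eq_0_iff)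

text \<open>
  The coefficient of a vector is the value of \<open>y\<close> at its tag. This survives elimination because
  the pivot is always the vector with the largest tag: it is added to vectors with smaller tags,
  so the tags that remain are the free variables of the system, and an eliminated \<open>y j\<close> is a
  combination of free variables with smaller index.
\<close>

definition elim_inv :: "(nat \<Rightarrow> bit) \<Rightarrow> nat \<Rightarrow> nat \<Rightarrow> (nat \<times> bool list) list \<Rightarrow> bool" where
  "elim_inv y h r s \<longleftrightarrow> sorted_wrt (>) (map fst s) \<and> (\<forall>(t, v)\<in>set s. t \<le> r \<and> h - r \<le> length v)
    \<and> (\<forall>i\<in>{r<..h}. (\<Sum>j\<in>{1..r}. y j * coef i j) = combination y s (i - r - 1))
    \<and> (\<forall>T. (\<forall>t\<in>fst ` set s. t \<le> T \<longrightarrow> y t = 0) \<longrightarrow> (\<forall>j\<in>{1..min T r}. y j = 0))"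

text \<open>The first conclusion serves unknowns already known to be 0, whose columns are left out;
  the second serves columns that enter the elimination.\<close>

lemma elim_inv_step:
  assumes inv: "elim_inv y h r s" and r: "r < h"
    and A: "(\<Sum>j\<in>{1..r}. y j * coef (Suc r) j) = 0"
  shows "y (Suc r) = 0 \<Longrightarrow> elim_inv y h (Suc r) (elim_row s)"
    and "binomial_column (r div 2) c \<Longrightarrow> h - Suc r \<le> length c
      \<Longrightarrow> elim_inv y h (Suc r) ((Suc r, c) # elim_row s)"
proof -
  have sorted: "sorted_wrt (>) (map fst s)"
    and bounds: "\<forall>(t, v)\<in>set s. t \<le> r \<and> h - r \<le> length v"
    and comb: "\<And>i. i \<in> {r<..h} \<Longrightarrow> (\<Sum>j\<in>{1..r}. y j * coef i j) = combination y s (i - r - 1)"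
    and zero: "\<And>T j. \<lbrakk>\<forall>t\<in>fst ` set s. t \<le> T \<longrightarrow> y t = 0; j \<in> {1..min T r}\<rbrakk> \<Longrightarrow> y j = 0"
    using inv unfolding elim_inv_def by blast+
  have c0: "combination y s 0 = 0"
    using comb[of "Suc r"] A r by simp
  have len: "\<forall>(t, v)\<in>set s. Suc (h - Suc r) \<le> length v"
    using bounds r by (auto simp: Suc_diff_Suc)
  have sorted': "sorted_wrt (>) (map fst (elim_row s))"
    using sorted by (rule sorted_elim_row)
  have len': "\<forall>(t, v)\<in>set (elim_row s). h - Suc r \<le> length v"
    using len by (rule length_elim_row)
  have tags': "t \<le> r" if t: "t \<in> fst ` set (elim_row s)" for t
  proof -
    obtain v where "(t, v) \<in> set s"
      using t set_elim_row_tags[of s] by fastforce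
    then show ?thesis using bounds by blast
  qed
  have comb': "(\<Sum>j\<in>{1..r}. y j * coef i j) = combination y (elim_row s) (i - Suc r - 1)"
    if "i \<in> {Suc r<..h}" for i
  proof -
    have "\<forall>(t, v)\<in>set s. Suc (i - Suc r - 1) < length v"
      using len that by fastforce
    then show ?thesis
      using comb[of i] that c0 by (simp add: combination_elim_row Suc_diff_Suc)
  qed
  have zero': "y j = 0" if "\<forall>t\<in>fst ` set (elim_row s). t \<le> T \<longrightarrow> y t = 0" "j \<in> {1..min T r}" for T j
  proof -
    have "\<forall>(t, v)\<in>set s. v \<noteq> []" using len by auto
    from tags_elim_row[OF sorted this c0 that(1)] show ?thesis
      using zero that(2) by blast
  qed
  show "elim_inv y h (Suc r) (elim_row s)" if "y (Suc r) = 0"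
    unfolding elim_inv_def
  proof (intro conjI allI impI ballI)
    show "y j = 0" if "\<forall>t\<in>fst ` set (elim_row s). t \<le> T \<longrightarrow> y t = 0" "j \<in> {1..min T (Suc r)}" for T j
      using that zero'[of T j] \<open>y (Suc r) = 0\<close> by (cases "j = Suc r") auto
  qed (use sorted' len' tags' comb' that in \<open>force+\<close>)
  assume c: "binomial_column (r div 2) c" "h - Suc r \<le> length c"
  show "elim_inv y h (Suc r) ((Suc r, c) # elim_row s)"
    unfolding elim_inv_def
  proof (intro conjI allI impI ballI)
    fix i assume i: "i \<in> {Suc r<..h}"
    then have "i - Suc r - 1 < length c" using c(2) by auto
    then have "of_bool (c ! (i - Suc r - 1)) = coef i (Suc r)"
      using c(1) i by (auto simp: binomial_column_def coef_def Suc_diff_Suc)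
    then show "(\<Sum>j\<in>{1..Suc r}. y j * coef i j) =
        combination y ((Suc r, c) # elim_row s) (i - Suc r - 1)"
      using comb'[OF i] by simp
  next
    show "y j = 0" if "\<forall>t\<in>fst ` set ((Suc r, c) # elim_row s). t \<le> T \<longrightarrow> y t = 0" "j \<in> {1..min T (Suc r)}" for T j
      using that zero'[of T j] by (cases "j = Suc r") auto
  qed (use sorted' len' tags' c in \<open>force+\<close>)
qed

lemma elim_inv_add_columns:
  assumes A: "\<And>i. i \<in> {1..h} \<Longrightarrow> (\<Sum>j\<in>{1..<i}. y j * coef i j) = 0"
    and low: "\<And>j. j \<in> {1..J} \<Longrightarrow> y j = 0" and "d \<le> h"
  shows "r \<le> d \<Longrightarrow> elim_inv y h r s \<Longrightarrow> binomial_column (r div 2) c \<Longrightarrow> length c = h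
    \<Longrightarrow> elim_inv y h d (add_columns J [Suc r..<Suc d] c s)"
proof (induction "d - r" arbitrary: r s c)
  case 0
  then show ?case by simp
next
  case (Suc m)
  then have r: "r < d" by simp
  have eq: "(\<Sum>j\<in>{1..r}. y j * coef (Suc r) j) = 0"
    using A[of "Suc r"] r \<open>d \<le> h\<close> by (simp add: atLeastLessThanSuc_atLeastAtMost)
  define s' where "s' = (if J < Suc r then (Suc r, c) # elim_row s else elim_row s)"
  define c' where "c' = (if even (Suc r) then prefix_sums True c else c)"
  have "elim_inv y h (Suc r) s'"
    using elim_inv_step[OF Suc.prems(2) _ eq] low[of "Suc r"] Suc.prems r \<open>d \<le> h\<close>
    by (auto simp: s'_def)
  moreover have "binomial_column (Suc r div 2) c'"
    using Suc.prems(3) binomial_column_prefix_sums[OF Suc.prems(3)] by (auto simp: c'_def)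
  moreover have "length c' = h"
    using Suc.prems(4) by (simp add: c'_def)
  ultimately have "elim_inv y h d (add_columns J [Suc (Suc r)..<Suc d] c' s')"
    using Suc.hyps r by (intro Suc.hyps(1)) auto
  moreover have "[Suc r..<Suc d] = Suc r # [Suc (Suc r)..<Suc d]"
    using r by (simp add: upt_conv_Cons)
  ultimately show ?case
    by (simp add: s'_def c'_def del: upt_Suc)
qed

text \<open>If every free variable has index above \<open>T\<close>, the last clause of
  \<open>elim_inv\<close> applies vacuously up to \<open>T\<close>.\<close>

lemma eliminate_sound:
  assumes A: "\<And>i. i \<in> {1..h} \<Longrightarrow> (\<Sum>j\<in>{1..<i}. y j * coef i j) = 0"
    and low: "\<And>j. j \<in> {1..J} \<Longrightarrow> y j = 0"
    and high: "\<And>j. j \<in> {d<..h} \<Longrightarrow> y j = 0" and "d \<le> h"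
    and tags: "\<forall>t\<in>set (map fst (eliminate J d h)). T < t" and j: "j \<in> {1..min T h}"
  shows "y j = 0"
proof -
  let ?s = "add_columns J [1..<Suc d] (replicate h True) []"
  have "elim_inv y h 0 []"
    by (simp add: elim_inv_def)
  moreover have "binomial_column 0 (replicate h True)"
    by (simp add: binomial_column_def)
  ultimately have start: "elim_inv y h d ?s"
    using \<open>d \<le> h\<close> A low elim_inv_add_columns[of h y J d 0 "[]" "replicate h True"] by (simp del: upt_Suc)
  \<comment> \<open>Beyond \<open>d\<close> the unknowns vanish, so equations are processed without
    adding columns.\<close>
  have "elim_inv y h (d + m) ((elim_row ^^ m) ?s)" if "d + m \<le> h" for m
    using that
  proof (induction m)
    case (Suc m)
    then have "(\<Sum>j\<in>{1..d + m}. y j * coef (Suc (d + m)) j) = 0"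
      using A[of "Suc (d + m)"] by (simp add: atLeastLessThanSuc_atLeastAtMost)
    then show ?case
      using elim_inv_step(1)[of y h "d + m"] Suc high[of "Suc (d + m)"] by simp
  qed (use start in simp)
  from this[of "h - d"] have "elim_inv y h h (eliminate J d h)"
    using \<open>d \<le> h\<close> by (simp add: eliminate_def)
  moreover have "\<forall>t\<in>fst ` set (eliminate J d h). t \<le> T \<longrightarrow> y t = 0"
    using tags by force
  ultimately show ?thesis
    using j unfolding elim_inv_def by blast
qed

section \<open>The linear system on the axis and the growth of its gaps\<close>

locale axis_system =
  fixes M :: nat and y :: "nat \<Rightarrow> bit"
  assumes equation: "h \<in> {1..<M} \<Longrightarrow> (\<Sum>j\<in>{1..<h}. y j * coef h j) = 0"
    and base_zero: "J < M \<Longrightarrow> (\<And>j. j \<in> {1..J} \<Longrightarrow> y j = 0) \<Longrightarrow> y (M - 1 - J) = 0"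
    and middle_zero: "J < M \<Longrightarrow> (\<And>j. j \<in> {1..J} \<Longrightarrow> y j = 0) \<Longrightarrow>
      M - 1 - J \<le> 2 * i \<Longrightarrow> 2 * i \<le> M + J \<Longrightarrow> y i = 0"
begin

definition vanish :: "nat \<Rightarrow> bool" where
  "vanish J \<longleftrightarrow> (\<forall>j\<in>{1..J}. y j = 0)"

lemma vanish_start:
  assumes "\<forall>t\<in>set (map fst (eliminate 0 h h)). T < t" "T \<le> h" "h < M"
  shows "vanish T"
  unfolding vanish_def
proof
  fix j assume "j \<in> {1..T}"
  then show "y j = 0"
    using assms by (intro eliminate_sound[of h y 0 h T j] equation) auto
qed

text \<open>The last two inequalities put \<open>d + 1, ..., h\<close> inside the middle gap from
  \<open>middle_zero\<close>, so only the columns \<open>J + 1, ..., d\<close> are left.\<close>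

lemma vanish_step:
  assumes "vanish J" "\<forall>t\<in>set (map fst (eliminate J d h)). T < t"
    and "T \<le> h" "d \<le> h" "h < M" "2 * h \<le> M + J" "M \<le> 2 * d + J + 3"
  shows "vanish T"
  unfolding vanish_def
proof
  fix j assume "j \<in> {1..T}"
  show "y j = 0"
  proof (cases "J < M")
    case True
    show ?thesis
    proof (rule eliminate_sound[of h y J d T j])
      show "y i = 0" if "i \<in> {d<..h}" for i
        by (rule middle_zero[of J]) (use that assms True in \<open>auto simp: vanish_def\<close>)
    qed (use assms equation \<open>j \<in> {1..T}\<close> in \<open>auto simp: vanish_def\<close>)
  next
    case False
    then show ?thesis
      using assms \<open>j \<in> {1..T}\<close> by (auto simp: vanish_def)
  qed
qed

lemma vanish_step_all:
  assumes "vanish J" "eliminate J d h = []"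
    and "d \<le> h" "h < M" "2 * h \<le> M + J" "M \<le> 2 * d + J + 3"
  shows "vanish h"
  using vanish_step[of J d h h] assms by simp

text \<open>The bound on \<open>M\<close> lets the middle gap start no later than
  \<open>J + 1\<close>. The zeros then run past the midpoint, and \<open>base_zero\<close> carries
  them to the other half.\<close>

lemma vanish_finish:
  assumes "vanish J" "M \<le> 3 * J + 3" "i < M"
  shows "y i = 0"
proof -
  define K where "K = (if J < M then (M + J) div 2 else J)"
  have K: "y j = 0" if "j \<in> {1..K}" for j
  proof (cases "J < M \<and> J < j")
    case True
    show ?thesis
      by (rule middle_zero[of J]) (use that assms(1,2) True in \<open>auto simp: vanish_def K_def\<close>)
  qed (use that assms(1) in \<open>auto simp: vanish_def K_def split: if_splits\<close>)
  have pos: "y j = 0" if "j \<in> {1..<M}" for j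
  proof (cases "j \<le> K")
    case False
    have "y (M - 1 - (M - 1 - j)) = 0"
    proof (rule base_zero)
      show "y l = 0" if "l \<in> {1..M - 1 - j}" for l
        using that False by (intro K) (auto simp: K_def split: if_splits)
    qed (use that in auto)
    then show ?thesis using that by simp
  qed (use that K in auto)
  \<comment> \<open>Index 0 occurs in no equation; it is reached by \<open>base_zero\<close> with
    all positive indices known to vanish.\<close>
  have "y (M - 1 - (M - 1)) = 0"
    by (rule base_zero) (use pos \<open>i < M\<close> in auto)
  then show ?thesis
    using pos \<open>i < M\<close> by (cases "i = 0") auto
qed

end

section \<open>Computed eliminations\<close>

lemma eliminate_0_2: "\<forall>t\<in>set (map fst (eliminate 0 2 2)). 1 < t"
  unfolding eliminate_def by code_simp

lemma eliminate_0_5: "\<forall>t\<in>set (map fst (eliminate 0 5 5)). 3 < t"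
  unfolding eliminate_def by code_simp

lemma eliminate_0_8: "\<forall>t\<in>set (map fst (eliminate 0 8 8)). 6 < t"
  unfolding eliminate_def by code_simp

lemma eliminate_0_16: "\<forall>t\<in>set (map fst (eliminate 0 16 16)). 11 < t"
  unfolding eliminate_def by code_simp

lemma eliminate_0_20: "\<forall>t\<in>set (map fst (eliminate 0 20 20)). 14 < t"
  unfolding eliminate_def by code_simp

lemma eliminate_0_97: "\<forall>t\<in>set (map fst (eliminate 0 97 97)). 46 < t"
  unfolding eliminate_def by code_simp

lemma eliminate_0_113: "\<forall>t\<in>set (map fst (eliminate 0 113 113)). 59 < t"
  unfolding eliminate_def by code_simp

text \<open>An empty result leaves no free variable, so every unknown up to \<open>h = 24\<close>
  vanishes.\<close>

lemma eliminate_14_15_24: "eliminate 14 15 24 = []"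
  unfolding eliminate_def by code_simp

lemma eliminate_14_25_32: "eliminate 14 25 32 = []"
  unfolding eliminate_def by code_simp

lemma eliminate_14_39_42: "\<forall>t\<in>set (map fst (eliminate 14 39 42)). 27 < t"
  unfolding eliminate_def by code_simp

lemma eliminate_27_33_49: "eliminate 27 33 49 = []"
  unfolding eliminate_def by code_simp

lemma eliminate_46_49_72: "eliminate 46 49 72 = []"
  unfolding eliminate_def by code_simp

lemma eliminate_59_95_105: "\<forall>t\<in>set (map fst (eliminate 59 95 105)). 62 < t"
  unfolding eliminate_def by code_simp

lemma eliminate_62_93_106: "\<forall>t\<in>set (map fst (eliminate 62 93 106)). 91 < t"
  unfolding eliminate_def by code_simp

lemma eliminate_59_137_157: "\<forall>t\<in>set (map fst (eliminate 59 137 157)). 62 < t"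
  unfolding eliminate_def by code_simp

lemma eliminate_62_135_158: "\<forall>t\<in>set (map fst (eliminate 62 135 158)). 94 < t"
  unfolding eliminate_def by code_simp

lemma eliminate_94_119_174: "eliminate 94 119 174 = []"
  unfolding eliminate_def by code_simp

lemma eliminate_59_177_199: "eliminate 59 177 199 = []"
  unfolding eliminate_def by code_simp

lemma eliminate_59_223_239: "\<forall>t\<in>set (map fst (eliminate 59 223 239)). 62 < t"
  unfolding eliminate_def by code_simp

lemma eliminate_62_221_240: "eliminate 62 221 240 = []"
  unfolding eliminate_def by code_simp

lemma eliminate_59_261_285: "\<forall>t\<in>set (map fst (eliminate 59 261 285)). 110 < t"
  unfolding eliminate_def by code_simp

lemma eliminate_110_235_310: "eliminate 110 235 310 = []"
  unfolding eliminate_def by code_simp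

lemma eliminate_59_309_323: "\<forall>t\<in>set (map fst (eliminate 59 309 323)). 110 < t"
  unfolding eliminate_def by code_simp

lemma eliminate_110_283_348: "\<forall>t\<in>set (map fst (eliminate 110 283 348)). 222 < t"
  unfolding eliminate_def by code_simp

lemma eliminate_222_227_404: "eliminate 222 227 404 = []"
  unfolding eliminate_def by code_simp

lemma eliminate_59_343_371: "\<forall>t\<in>set (map fst (eliminate 59 343 371)). 123 < t"
  unfolding eliminate_def by code_simp

lemma eliminate_123_311_403: "eliminate 123 311 403 = []"
  unfolding eliminate_def by code_simp

section \<open>Vanishing of the axis entries for \<open>M\<close> up to 747\<close>

context axis_system
begin

lemma zero_upto_3:
  assumes "M mod 4 = 3" "M \<le> 3" "i < M"
  shows "y i = 0"
proof -
  have "3 \<le> M"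
    using assms by presburger
  then have "vanish 1"
    by (intro vanish_start[OF eliminate_0_2]) auto
  then show ?thesis
    using assms by (intro vanish_finish) auto
qed

lemma zero_upto_7:
  assumes "M mod 4 = 3" "M \<le> 7" "i < M"
  shows "y i = 0"
proof (cases "M \<le> 3")
  case True
  then show ?thesis
    using assms zero_upto_3 by blast
next
  case False
  \<comment> \<open>The residue 3 modulo 4 lifts \<open>M\<close> from above 3 to at least
    7.\<close>
  then have "7 \<le> M"
    using assms by presburger
  then have "vanish 3"
    by (intro vanish_start[OF eliminate_0_5]) auto
  then show ?thesis
    using assms by (intro vanish_finish) auto
qed

lemma zero_upto_15:
  assumes "M mod 4 = 3" "M \<le> 15" "i < M"
  shows "y i = 0"
proof (cases "M \<le> 7")
  case True
  then show ?thesis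
    using assms zero_upto_7 by blast
next
  case False
  then have "11 \<le> M"
    using assms by presburger
  then have "vanish 6"
    by (intro vanish_start[OF eliminate_0_8]) auto
  then show ?thesis
    using assms by (intro vanish_finish) auto
qed

lemma zero_upto_31:
  assumes "M mod 4 = 3" "M \<le> 31" "i < M"
  shows "y i = 0"
proof (cases "M \<le> 15")
  case True
  then show ?thesis
    using assms zero_upto_15 by blast
next
  case False
  then have "19 \<le> M"
    using assms by presburger
  then have "vanish 11"
    by (intro vanish_start[OF eliminate_0_16]) auto
  then show ?thesis
    using assms by (intro vanish_finish) auto
qed

text \<open>The new range 35 to 47 is what \<open>eliminate 14 15 24\<close> serves: its lower end
  gives \<open>2 * 24 \<le> M + 14\<close>, its upper end \<open>M \<le> 2 * 15 + 14 + 3\<close>.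
  Later ranges are cut in the same way.\<close>

lemma zero_upto_47:
  assumes "M mod 4 = 3" "M \<le> 47" "i < M"
  shows "y i = 0"
proof (cases "M \<le> 31")
  case True
  then show ?thesis
    using assms zero_upto_31 by blast
next
  case False
  then have "35 \<le> M"
    using assms by presburger
  then have "vanish 14"
    by (intro vanish_start[OF eliminate_0_20]) auto
  then have "vanish 24"
    using \<open>35 \<le> M\<close> assms by (intro vanish_step_all[OF _ eliminate_14_15_24]) auto
  then show ?thesis
    using assms by (intro vanish_finish) auto
qed

lemma zero_upto_67:
  assumes "M mod 4 = 3" "M \<le> 67" "i < M"
  shows "y i = 0"
proof (cases "M \<le> 47")
  case True
  then show ?thesis
    using assms zero_upto_47 by blast
next
  case False
  then have "51 \<le> M"
    using assms by presburger
  then have "vanish 14"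
    by (intro vanish_start[OF eliminate_0_20]) auto
  then have "vanish 32"
    using \<open>51 \<le> M\<close> assms by (intro vanish_step_all[OF _ eliminate_14_25_32]) auto
  then show ?thesis
    using assms by (intro vanish_finish) auto
qed

lemma zero_upto_95:
  assumes "M mod 4 = 3" "M \<le> 95" "i < M"
  shows "y i = 0"
proof (cases "M \<le> 67")
  case True
  then show ?thesis
    using assms zero_upto_67 by blast
next
  case False
  then have "71 \<le> M"
    using assms by presburger
  then have "vanish 14"
    by (intro vanish_start[OF eliminate_0_20]) auto
  \<comment> \<open>A round that leaves free variables still widens the gaps, and the next round
    starts from the wider ones.\<close>
  then have "vanish 27"
    using \<open>71 \<le> M\<close> assms by (intro vanish_step[OF _ eliminate_14_39_42]) auto
  then have "vanish 49"
    using \<open>71 \<le> M\<close> assms by (intro vanish_step_all[OF _ eliminate_27_33_49]) auto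
  then show ?thesis
    using assms by (intro vanish_finish) auto
qed

lemma zero_upto_147:
  assumes "M mod 4 = 3" "M \<le> 147" "i < M"
  shows "y i = 0"
proof (cases "M \<le> 95")
  case True
  then show ?thesis
    using assms zero_upto_95 by blast
next
  case False
  then have "99 \<le> M"
    using assms by presburger
  then have "vanish 46"
    by (intro vanish_start[OF eliminate_0_97]) auto
  then have "vanish 72"
    using \<open>99 \<le> M\<close> assms by (intro vanish_step_all[OF _ eliminate_46_49_72]) auto
  then show ?thesis
    using assms by (intro vanish_finish) auto
qed

lemma zero_upto_251:
  assumes "M mod 4 = 3" "M \<le> 251" "i < M"
  shows "y i = 0"
proof (cases "M \<le> 147")
  case True
  then show ?thesis
    using assms zero_upto_147 by blast
next
  case False
  then have "151 \<le> M"
    using assms by presburger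
  then have "vanish 59"
    by (intro vanish_start[OF eliminate_0_113]) auto
  then have "vanish 62"
    using \<open>151 \<le> M\<close> assms by (intro vanish_step[OF _ eliminate_59_95_105]) auto
  then have "vanish 91"
    using \<open>151 \<le> M\<close> assms by (intro vanish_step[OF _ eliminate_62_93_106]) auto
  then show ?thesis
    using assms by (intro vanish_finish) auto
qed

lemma zero_upto_335:
  assumes "M mod 4 = 3" "M \<le> 335" "i < M"
  shows "y i = 0"
proof (cases "M \<le> 251")
  case True
  then show ?thesis
    using assms zero_upto_251 by blast
next
  case False
  then have "255 \<le> M"
    using assms by presburger
  then have "vanish 59"
    by (intro vanish_start[OF eliminate_0_113]) auto
  then have "vanish 62"
    using \<open>255 \<le> M\<close> assms by (intro vanish_step[OF _ eliminate_59_137_157]) auto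
  then have "vanish 94"
    using \<open>255 \<le> M\<close> assms by (intro vanish_step[OF _ eliminate_62_135_158]) auto
  then have "vanish 174"
    using \<open>255 \<le> M\<close> assms by (intro vanish_step_all[OF _ eliminate_94_119_174]) auto
  then show ?thesis
    using assms by (intro vanish_finish) auto
qed

lemma zero_upto_415:
  assumes "M mod 4 = 3" "M \<le> 415" "i < M"
  shows "y i = 0"
proof (cases "M \<le> 335")
  case True
  then show ?thesis
    using assms zero_upto_335 by blast
next
  case False
  then have "339 \<le> M"
    using assms by presburger
  then have "vanish 59"
    by (intro vanish_start[OF eliminate_0_113]) auto
  then have "vanish 199"
    using \<open>339 \<le> M\<close> assms by (intro vanish_step_all[OF _ eliminate_59_177_199]) auto
  then show ?thesis
    using assms by (intro vanish_finish) auto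
qed

lemma zero_upto_507:
  assumes "M mod 4 = 3" "M \<le> 507" "i < M"
  shows "y i = 0"
proof (cases "M \<le> 415")
  case True
  then show ?thesis
    using assms zero_upto_415 by blast
next
  case False
  then have "419 \<le> M"
    using assms by presburger
  then have "vanish 59"
    by (intro vanish_start[OF eliminate_0_113]) auto
  then have "vanish 62"
    using \<open>419 \<le> M\<close> assms by (intro vanish_step[OF _ eliminate_59_223_239]) auto
  then have "vanish 240"
    using \<open>419 \<le> M\<close> assms by (intro vanish_step_all[OF _ eliminate_62_221_240]) auto
  then show ?thesis
    using assms by (intro vanish_finish) auto
qed

lemma zero_upto_583:
  assumes "M mod 4 = 3" "M \<le> 583" "i < M"
  shows "y i = 0"
proof (cases "M \<le> 507")
  case True
  then show ?thesis
    using assms zero_upto_507 by blast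
next
  case False
  then have "511 \<le> M"
    using assms by presburger
  then have "vanish 59"
    by (intro vanish_start[OF eliminate_0_113]) auto
  then have "vanish 110"
    using \<open>511 \<le> M\<close> assms by (intro vanish_step[OF _ eliminate_59_261_285]) auto
  then have "vanish 310"
    using \<open>511 \<le> M\<close> assms by (intro vanish_step_all[OF _ eliminate_110_235_310]) auto
  then show ?thesis
    using assms by (intro vanish_finish) auto
qed

lemma zero_upto_679:
  assumes "M mod 4 = 3" "M \<le> 679" "i < M"
  shows "y i = 0"
proof (cases "M \<le> 583")
  case True
  then show ?thesis
    using assms zero_upto_583 by blast
next
  case False
  then have "587 \<le> M"
    using assms by presburger
  then have "vanish 59"
    by (intro vanish_start[OF eliminate_0_113]) auto
  then have "vanish 110"
    using \<open>587 \<le> M\<close> assms by (intro vanish_step[OF _ eliminate_59_309_323]) auto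
  then have "vanish 222"
    using \<open>587 \<le> M\<close> assms by (intro vanish_step[OF _ eliminate_110_283_348]) auto
  then have "vanish 404"
    using \<open>587 \<le> M\<close> assms by (intro vanish_step_all[OF _ eliminate_222_227_404]) auto
  then show ?thesis
    using assms by (intro vanish_finish) auto
qed

lemma zero_upto_747:
  assumes "M mod 4 = 3" "M \<le> 747" "i < M"
  shows "y i = 0"
proof (cases "M \<le> 679")
  case True
  then show ?thesis
    using assms zero_upto_679 by blast
next
  case False
  then have "683 \<le> M"
    using assms by presburger
  then have "vanish 59"
    by (intro vanish_start[OF eliminate_0_113]) auto
  then have "vanish 123"
    using \<open>683 \<le> M\<close> assms by (intro vanish_step[OF _ eliminate_59_343_371]) auto
  then have "vanish 403"
    using \<open>683 \<le> M\<close> assms by (intro vanish_step_all[OF _ eliminate_123_311_403]) auto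
  then show ?thesis
    using assms by (intro vanish_finish) auto
qed

end

section \<open>Triangles with the symmetry of an equilateral triangle\<close>

text \<open>\<open>reflect\<close> and \<open>palindrome\<close> generate the six symmetries of the
  triangle; \<open>top_middle\<close> and \<open>axis\<close> are what the degrees
  contribute.\<close>

locale symmetric_triangle =
  fixes M :: nat and t :: "nat \<Rightarrow> nat \<Rightarrow> bit"
  assumes M_pos: "1 \<le> M"
    and rule: "\<lbrakk>1 \<le> i; Suc i < j; j \<le> 2 * M + 2\<rbrakk> \<Longrightarrow> t (Suc i) j = t i (j - 1) + t i j"
    and reflect: "\<lbrakk>1 \<le> i; i < j; j \<le> 2 * M + 2\<rbrakk> \<Longrightarrow> t i j = t (2 * M + 3 - j) (2 * M + 3 - i)"
    and palindrome: "\<lbrakk>1 \<le> i; i < j; j \<le> 2 * M + 2\<rbrakk> \<Longrightarrow> t i j = t i (2 * M + 3 + i - j)"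
    and top_middle: "t 1 (M + 2) = 0"
    and axis: "\<lbrakk>even k; 2 \<le> k; k \<le> 2 * M\<rbrakk> \<Longrightarrow> t k (k + 2) = t k (M + 1 + k div 2)"
begin

text \<open>The third reflection of the triangle, obtained by conjugating the row palindrome with
  the antidiagonal reflection.\<close>

lemma column_palindrome:
  assumes "1 \<le> i" "i < j" "j \<le> 2 * M + 2"
  shows "t i j = t (j - i) j"
proof -
  have "t i j = t (2 * M + 3 - j) (2 * M + 3 - i)"
    using assms by (rule reflect)
  also have "\<dots> = t (2 * M + 3 - j) (2 * M + 3 + (2 * M + 3 - j) - (2 * M + 3 - i))"
    using assms by (intro palindrome) auto
  also have "\<dots> = t (2 * M + 3 - (2 * M + 3 + (2 * M + 3 - j) - (2 * M + 3 - i))) (2 * M + 3 - (2 * M + 3 - j))"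
    using assms by (intro reflect) auto
  also have "2 * M + 3 - (2 * M + 3 + (2 * M + 3 - j) - (2 * M + 3 - i)) = j - i"
    using assms by auto
  also have "2 * M + 3 - (2 * M + 3 - j) = j"
    using assms by auto
  finally show ?thesis .
qed

text \<open>
  The row with index \<open>2 * M + 2 - L\<close> has length \<open>L\<close>. \<open>W s h\<close> and \<open>Z s h\<close> are the entries \<open>s\<close> places
  to the left of the middle in the rows of length \<open>2 * h + 2\<close> and \<open>2 * h + 3\<close>, and \<open>y h = W 0 h\<close>.
\<close>

definition y :: "nat \<Rightarrow> bit" where
  "y h = t (2 * M - 2 * h) (2 * M + 1 - h)"

definition Z :: "nat \<Rightarrow> nat \<Rightarrow> bit" where
  "Z s h = t (2 * M - 1 - 2 * h) (2 * M + 1 - h - s)"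

definition W :: "nat \<Rightarrow> nat \<Rightarrow> bit" where
  "W s h = t (2 * M - 2 * h) (2 * M + 1 - h - s)"

lemma W_eq:
  assumes "h < M" "s \<le> h"
  shows "W s h = Z (Suc s) h + Z s h"
proof -
  have "Suc (2 * M - 1 - 2 * h) = 2 * M - 2 * h"
    using assms by auto
  then show ?thesis
    using rule[of "2 * M - 1 - 2 * h" "2 * M + 1 - h - s"] assms by (simp add: W_def Z_def)
qed

text \<open>The two middle entries of the row above are equal and cancel; for the top row
  \<open>top_middle\<close> takes over.\<close>

lemma Z_0:
  assumes "h < M"
  shows "Z 0 h = 0"
proof (cases "h = M - 1")
  case True
  then have "2 * M - 1 - 2 * h = 1" "2 * M + 1 - h = M + 2"
    using M_pos by auto
  then show ?thesis
    using top_middle by (simp add: Z_def)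
next
  case False
  let ?i = "2 * M - 2 - 2 * h"
  have h: "h + 2 \<le> M" using False assms by auto
  then have eqs: "Suc ?i = 2 * M - 1 - 2 * h" "2 * M + 1 - h - 1 = 2 * M - h"
    "2 * M + 3 + ?i - (2 * M + 1 - h) = 2 * M - h"
    by auto
  have "t (Suc ?i) (2 * M + 1 - h) = t ?i (2 * M + 1 - h - 1) + t ?i (2 * M + 1 - h)"
    using h by (intro rule) auto
  moreover have "t ?i (2 * M + 1 - h) = t ?i (2 * M + 3 + ?i - (2 * M + 1 - h))"
    using h by (intro palindrome) auto
  ultimately show ?thesis
    unfolding eqs Z_def by simp
qed

lemma Z_1: "h < M \<Longrightarrow> Z 1 h = y h"
  using W_eq[of h 0] Z_0[of h] by (simp add: W_def y_def)

text \<open>Two steps of the triangle rule, whose doubled middle term cancels.\<close>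

lemma Z_rec:
  assumes "Suc h < M" "s \<le> h"
  shows "Z (Suc (Suc s)) (Suc h) = Z (Suc s) h + Z s (Suc h)"
proof -
  let ?i = "2 * M - 2 * Suc h" and ?j = "2 * M + 1 - h - Suc s"
  have eqs: "Suc ?i = 2 * M - 1 - 2 * h" "?j - 1 = 2 * M + 1 - Suc h - Suc s"
    "?j = 2 * M + 1 - Suc h - s"
    using assms by auto
  have "t (Suc ?i) ?j = t ?i (?j - 1) + t ?i ?j"
    using assms by (intro rule) auto
  then have "Z (Suc s) h = W (Suc s) (Suc h) + W s (Suc h)"
    unfolding Z_def W_def eqs(1,2) by (simp add: eqs(3)[symmetric])
  then show ?thesis
    using assms by (simp add: W_eq add.assoc)
qed

text \<open>Solves the Fibonacci-like recursion \<open>Z_rec\<close> from \<open>Z 0 h = 0\<close>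
  and \<open>Z 1 h = y h\<close> by Pascal's rule. The binomials vanish for
  \<open>2 * k \<ge> s\<close>, so no index above \<open>h\<close> really enters.\<close>

lemma Z_eq:
  "h < M \<Longrightarrow> s \<le> Suc h \<Longrightarrow>
    Z s h = (\<Sum>k<s. of_nat ((s - 1 - k) choose k) * y (h + 1 + 2 * k - s))"
proof (induction s arbitrary: h rule: induct_nat_012)
  case 0
  then show ?case by (simp add: Z_0)
next
  case 1
  then show ?case using Z_1 by simp
next
  case (ge2 s)
  then obtain h' where h: "h = Suc h'" by (cases h) auto
  have "(\<Sum>k<Suc (Suc s). of_nat ((Suc s - k) choose k) * y (h + 1 + 2 * k - Suc (Suc s)))
      = y (h - Suc s) + (\<Sum>k<Suc s. of_nat ((s - k) choose Suc k) * y (h + 1 + 2 * k - s))"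
    by (subst sum.lessThan_Suc_shift) (auto intro!: sum.cong arg_cong2[where f = "(*)"] arg_cong[where f = y])
  also have "(\<Sum>k<Suc s. of_nat ((s - k) choose Suc k) * y (h + 1 + 2 * k - s))
      = (\<Sum>k<s. of_nat ((s - k) choose Suc k) * y (h + 1 + 2 * k - s))"
    by simp
  also have "\<dots> = (\<Sum>k<s. of_nat ((s - 1 - k) choose Suc k) * y (h + 1 + 2 * k - s))
      + (\<Sum>k<s. of_nat ((s - 1 - k) choose k) * y (h + 1 + 2 * k - s))"
    unfolding sum.distrib[symmetric]
  proof (intro sum.cong refl)
    fix k assume "k \<in> {..<s}"
    then have "s - k = Suc (s - 1 - k)" by auto
    then have "(s - k) choose Suc k = ((s - 1 - k) choose k) + ((s - 1 - k) choose Suc k)"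
      by (metis binomial_Suc_Suc)
    then show "of_nat ((s - k) choose Suc k) * y (h + 1 + 2 * k - s) =
      of_nat ((s - 1 - k) choose Suc k) * y (h + 1 + 2 * k - s)
      + of_nat ((s - 1 - k) choose k) * y (h + 1 + 2 * k - s)"
      by (simp add: algebra_simps)
  qed
  also have "(\<Sum>k<s. of_nat ((s - 1 - k) choose k) * y (h + 1 + 2 * k - s)) = Z s h"
    using ge2 by simp
  also have "y (h - Suc s) + ((\<Sum>k<s. of_nat ((s - 1 - k) choose Suc k) * y (h + 1 + 2 * k - s)) + Z s h)
      = (\<Sum>k<Suc s. of_nat ((s - k) choose k) * y (h' + 1 + 2 * k - Suc s)) + Z s h"
    by (subst sum.lessThan_Suc_shift)
      (auto simp: h add.assoc intro!: sum.cong arg_cong2[where f = "(*)"] arg_cong[where f = y])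
  also have "(\<Sum>k<Suc s. of_nat ((s - k) choose k) * y (h' + 1 + 2 * k - Suc s)) = Z (Suc s) h'"
    using ge2 h by simp
  also have "Z (Suc s) h' + Z s h = Z (Suc (Suc s)) h"
    using Z_rec[of h' s] ge2 h by simp
  finally show ?case by simp
qed

text \<open>The reflection sends the second entry of an odd row to the second entry of an even row,
  which \<open>axis\<close> moves to the middle.\<close>

lemma Z_diag:
  assumes "j < M"
  shows "Z j j = y (M - 1 - j)"
proof -
  let ?i = "2 * M - 1 - 2 * j"
  have eqs: "2 * M + 3 - (2 * M + 1 - j - j) = 2 * j + 2" "2 * M + 3 - ?i = 2 * j + 2 + 2"
    using assms by auto
  have "Z j j = t (2 * M + 3 - (2 * M + 1 - j - j)) (2 * M + 3 - ?i)"
    unfolding Z_def using assms by (intro reflect) auto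
  also have "\<dots> = t (2 * j + 2) (M + 1 + (2 * j + 2) div 2)"
    unfolding eqs using assms by (intro axis) auto
  also have "\<dots> = y (M - 1 - j)"
  proof -
    have "2 * M - 2 * (M - 1 - j) = 2 * j + 2" "2 * M + 1 - (M - 1 - j) = M + 1 + (2 * j + 2) div 2"
      using assms by auto
    then show ?thesis by (simp add: y_def)
  qed
  finally show ?thesis .
qed

lemma Z_eq_0:
  assumes "h < M" "s \<le> Suc h" "\<And>i. h + 1 - s \<le> i \<Longrightarrow> i \<le> h \<Longrightarrow> y i = 0"
  shows "Z s h = 0"
proof -
  have "of_nat ((s - 1 - k) choose k) * y (h + 1 + 2 * k - s) = 0" if "k < s" for k
  proof (cases "2 * k < s")
    case True
    then show ?thesis using assms that by simp
  next
    case False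
    then show ?thesis using that by (simp add: binomial_eq_0)
  qed
  then show ?thesis
    unfolding Z_eq[OF assms(1,2)] by (intro sum.neutral) auto
qed

lemma y_base_zero:
  assumes "J < M" "\<And>j. j \<in> {1..J} \<Longrightarrow> y j = 0"
  shows "y (M - 1 - J) = 0"
proof -
  have "Z J J = 0"
    using assms by (intro Z_eq_0) auto
  then show ?thesis
    using assms by (simp add: Z_diag)
qed

text \<open>The column palindrome turns row 2 into the second entries of the rows \<open>p\<close>;
  \<open>axis\<close> evaluates these for even \<open>p\<close>, \<open>Z_diag\<close> for odd
  \<open>p\<close>.\<close>

lemma second_row:
  assumes "1 \<le> p" "p \<le> M"
  shows "t 2 (p + 2) = (if even p then y (M - p div 2) else y ((p - 1) div 2))"
proof -
  have *: "t 2 (p + 2) = t p (p + 2)"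
    using column_palindrome[of 2 "p + 2"] assms by simp
  show ?thesis
  proof (cases "even p")
    case True
    then have "2 * M - 2 * (M - p div 2) = p" "2 * M + 1 - (M - p div 2) = M + 1 + p div 2"
      using assms by auto
    then have "y (M - p div 2) = t p (M + 1 + p div 2)"
      by (simp add: y_def)
    then show ?thesis
      using True * axis[of p] assms by auto
  next
    case False
    then obtain q where p: "p = 2 * q + 1" by (auto elim: oddE)
    have "2 * M - 1 - 2 * (M - 1 - q) = p" "2 * M + 1 - (M - 1 - q) - (M - 1 - q) = p + 2"
      using assms p by auto
    then have "Z (M - 1 - q) (M - 1 - q) = t p (p + 2)"
      by (simp add: Z_def)
    moreover have "Z (M - 1 - q) (M - 1 - q) = y (M - 1 - (M - 1 - q))"
      using assms p by (intro Z_diag) auto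
    moreover have "M - 1 - (M - 1 - q) = q"
      using assms p by auto
    ultimately show ?thesis
      using * p by simp
  qed
qed

text \<open>The zeros next to \<open>M - 1\<close> make row 2 vanish within distance
  \<open>J\<close> of its middle, and \<open>second_row\<close> reads these entries as values of
  \<open>y\<close> near half of \<open>M\<close>.\<close>

lemma y_middle_zero:
  assumes J: "J < M" and zero: "\<And>j. j \<in> {1..J} \<Longrightarrow> y j = 0"
    and i: "M - 1 - J \<le> 2 * i" "2 * i \<le> M + J"
  shows "y i = 0"
proof -
  have W0: "t 2 (M - s + 2) = 0" if s: "s \<le> J" for s
  proof -
    have "y j = 0" if "M - 1 - s \<le> j" "j \<le> M - 1" for j
    proof -
      have "y (M - 1 - (M - 1 - j)) = 0"
        using zero s that J by (intro y_base_zero) auto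
      moreover have "M - 1 - (M - 1 - j) = j"
        using that by auto
      ultimately show ?thesis by simp
    qed
    then have "Z (Suc s) (M - 1) = 0" "Z s (M - 1) = 0"
      using J s by (auto intro!: Z_eq_0)
    then have "W s (M - 1) = 0"
      using J s by (simp add: W_eq)
    moreover have "2 * M - 2 * (M - 1) = 2" "2 * M + 1 - (M - 1) - s = M - s + 2"
      using J s by auto
    ultimately show ?thesis
      by (simp add: W_def)
  qed
  show ?thesis
  proof (cases "M \<le> 2 * i")
    case True
    then have "M - (2 * i - M) = 2 * (M - i)" "M - (M - i) = i"
      using i J by auto
    then show ?thesis
      using second_row[of "2 * (M - i)"] W0[of "2 * i - M"] True i J by simp
  next
    case False
    show ?thesis
      using second_row[of "M - (M - 1 - 2 * i)"] W0[of "M - 1 - 2 * i"] False i J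
      by (simp split: if_splits)
  qed
qed

text \<open>\<open>Z h h\<close> collects the odd indices and \<open>Z (h - 1) h\<close> the even
  ones, which is the origin of \<open>(j - 1) div 2\<close> in \<open>coef\<close>.\<close>

lemma coef_sum:
  assumes "1 \<le> h" "h < M"
  shows "(\<Sum>j\<in>{1..h}. y j * coef h j) = Z h h + Z (h - 1) h"
proof -
  have odd: "(\<Sum>j\<in>{j\<in>{1..h}. odd j}. y j * coef h j) = Z h h"
  proof -
    have "Z h h = (\<Sum>k<h. of_nat ((h - 1 - k) choose k) * y (2 * k + 1))"
      using assms by (simp add: Z_eq)
    also have "\<dots> = (\<Sum>k\<in>{k. 2 * k + 1 \<le> h}. of_nat ((h - 1 - k) choose k) * y (2 * k + 1))"
    proof (rule sum.mono_neutral_right)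
      show "\<forall>k\<in>{..<h} - {k. 2 * k + 1 \<le> h}. of_nat ((h - 1 - k) choose k) * y (2 * k + 1) = 0"
        by (auto simp: binomial_eq_0)
    qed auto
    also have "\<dots> = (\<Sum>j\<in>{j\<in>{1..h}. odd j}. y j * coef h j)"
      by (rule sum.reindex_bij_witness[of _ "\<lambda>j. (j - 1) div 2" "\<lambda>k. 2 * k + 1"])
        (auto simp: coef_def mult.commute elim!: oddE intro!: arg_cong[where f = of_nat] arg_cong2[where f = binomial] arg_cong2[where f = "(*)"])
    finally show ?thesis by simp
  qed
  have even: "(\<Sum>j\<in>{j\<in>{1..h}. even j}. y j * coef h j) = Z (h - 1) h"
  proof -
    have "Z (h - 1) h = (\<Sum>k<h - 1. of_nat ((h - 2 - k) choose k) * y (2 * k + 2))"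
      using assms Z_eq[of h "h - 1"] by (simp add: numeral_2_eq_2)
    also have "\<dots> = (\<Sum>k\<in>{k. 2 * k + 2 \<le> h}. of_nat ((h - 2 - k) choose k) * y (2 * k + 2))"
    proof (rule sum.mono_neutral_right)
      show "\<forall>k\<in>{..<h - 1} - {k. 2 * k + 2 \<le> h}. of_nat ((h - 2 - k) choose k) * y (2 * k + 2) = 0"
        by (auto simp: binomial_eq_0)
    qed auto
    also have "\<dots> = (\<Sum>j\<in>{j\<in>{1..h}. even j}. y j * coef h j)"
      by (rule sum.reindex_bij_witness[of _ "\<lambda>j. (j - 1) div 2" "\<lambda>k. 2 * k + 2"])
        (auto simp: coef_def mult.commute elim!: evenE intro!: arg_cong[where f = of_nat] arg_cong2[where f = binomial] arg_cong2[where f = "(*)"])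
    finally show ?thesis by simp
  qed
  have "{1..h} = {j\<in>{1..h}. odd j} \<union> {j\<in>{1..h}. even j}"
    by auto
  then have "(\<Sum>j\<in>{1..h}. y j * coef h j) =
      (\<Sum>j\<in>{j\<in>{1..h}. odd j}. y j * coef h j) + (\<Sum>j\<in>{j\<in>{1..h}. even j}. y j * coef h j)"
    by (metis (no_types, lifting) sum.union_disjoint finite_atLeastAtMost finite_Un disjoint_iff mem_Collect_eq)
  then show ?thesis
    using odd even by simp
qed

text \<open>By \<open>axis\<close> the second entry of the row equals \<open>y h\<close>. This
  cancels the diagonal term, leaving only smaller indices.\<close>

lemma y_equation:
  assumes "h \<in> {1..<M}"
  shows "(\<Sum>j\<in>{1..<h}. y j * coef h j) = 0"
proof -
  have eqs: "2 * M - 2 * h + 2 = 2 * M + 1 - h - (h - 1)" "M + 1 + (2 * M - 2 * h) div 2 = 2 * M + 1 - h"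
    using assms by auto
  have "t (2 * M - 2 * h) (2 * M - 2 * h + 2) = t (2 * M - 2 * h) (M + 1 + (2 * M - 2 * h) div 2)"
    using assms by (intro axis) auto
  then have "W (h - 1) h = y h"
    unfolding eqs W_def y_def .
  then have "Z h h + Z (h - 1) h = y h"
    using W_eq[of h "h - 1"] assms by simp
  then have "(\<Sum>j\<in>{1..h}. y j * coef h j) = y h"
    using assms coef_sum by simp
  moreover have "(\<Sum>j\<in>{1..h}. y j * coef h j) = y h * coef h h + (\<Sum>j\<in>{1..<h}. y j * coef h j)"
    using assms by (simp add: sum.atLeast_Suc_atMost_Suc_shift atLeastLessThanSuc_atLeastAtMost[symmetric] add.commute)
  moreover have "coef h h = 1"
    by (simp add: coef_def)
  ultimately show ?thesis
    by simp
qed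

sublocale axis_system M y
  by standard (fact y_equation y_base_zero y_middle_zero)+

lemma top_row_zero:
  assumes "\<And>i. i < M \<Longrightarrow> y i = 0" "2 \<le> j" "j \<le> 2 * M + 2"
  shows "t 1 j = 0"
proof -
  have left: "t 1 l = 0" if "2 \<le> l" "l \<le> M + 2" for l
  proof -
    have "Z (M + 2 - l) (M - 1) = 0"
      using assms(1) that M_pos by (intro Z_eq_0) auto
    moreover have "2 * M - 1 - 2 * (M - 1) = 1" "2 * M + 1 - (M - 1) - (M + 2 - l) = l"
      using that M_pos by auto
    ultimately show ?thesis
      by (simp add: Z_def)
  qed
  show ?thesis
  proof (cases "j \<le> M + 2")
    case False
    have "t 1 j = t 1 (2 * M + 3 + 1 - j)"
      using assms by (intro palindrome) auto
    then show ?thesis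
      using left[of "2 * M + 3 + 1 - j"] False assms by auto
  qed (use left assms in auto)
qed

end

section \<open>Degrees modulo 4 in the triangle\<close>

abbreviation weight :: "bit \<Rightarrow> nat" where
  "weight b \<equiv> of_bool (b = 1)"

lemma of_nat_weight [simp]: "of_nat (weight b) = b"
  by (cases b) auto

lemma of_nat_bit_eq_0_iff: "of_nat n = (0 :: bit) \<longleftrightarrow> even n"
  by (induction n) auto

lemma even_weight_sum: "even (\<Sum>x\<in>A. weight (f x)) \<longleftrightarrow> (\<Sum>x\<in>A. f x) = 0"
proof -
  have "(\<Sum>x\<in>A. f x) = of_nat (\<Sum>x\<in>A. weight (f x))"
    by (simp only: of_nat_sum of_nat_weight)
  then show ?thesis
    by (simp only: of_nat_bit_eq_0_iff)
qed

lemma bit_telescope: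
  fixes f :: "nat \<Rightarrow> bit"
  assumes "m \<le> n"
  shows "(\<Sum>j\<in>{Suc m..n}. f (j - 1) + f j) = f m + f n"
  using assms by (induction n rule: dec_induct) (auto simp: add.assoc)

lemma sum_palindrome:
  fixes f :: "nat \<Rightarrow> nat"
  assumes "\<And>p. p \<in> {1..n} \<Longrightarrow> f (n + 1 - p) = f p"
  shows "(\<Sum>p\<in>{1..n}. f p) = 2 * (\<Sum>p\<in>{1..n div 2}. f p) + (if odd n then f (n div 2 + 1) else 0)"
proof -
  let ?h = "n div 2"
  have "(\<Sum>p\<in>{n - ?h + 1..n}. f p) = (\<Sum>p\<in>{1..?h}. f p)"
    by (rule sum.reindex_bij_witness[of _ "\<lambda>p. n + 1 - p" "\<lambda>p. n + 1 - p"])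
      (use assms in \<open>auto simp: Suc_diff_le\<close>)
  moreover have "{1..n} = {1..?h} \<union> {?h + 1..n - ?h} \<union> {n - ?h + 1..n}"
    by auto
  then have "(\<Sum>p\<in>{1..n}. f p) = (\<Sum>p\<in>{1..?h}. f p) + (\<Sum>p\<in>{?h + 1..n - ?h}. f p) + (\<Sum>p\<in>{n - ?h + 1..n}. f p)"
    by (simp only:) (subst sum.union_disjoint; auto)+
  moreover have "{?h + 1..n - ?h} = (if odd n then {?h + 1} else {})"
    by (auto elim!: oddE evenE)
  ultimately show ?thesis
    by auto
qed

locale multisymmetric =
  fixes M D :: nat and t :: "nat \<Rightarrow> nat \<Rightarrow> bit"
  assumes M_pos: "1 \<le> M"
    and rule: "\<lbrakk>1 \<le> i; Suc i < j; j \<le> 2 * M + 2\<rbrakk> \<Longrightarrow> t (Suc i) j = t i (j - 1) + t i j"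
    and reflect: "\<lbrakk>1 \<le> i; i < j; j \<le> 2 * M + 2\<rbrakk> \<Longrightarrow> t i j = t (2 * M + 3 - j) (2 * M + 3 - i)"
    and palindrome: "\<lbrakk>1 \<le> i; i < j; j \<le> 2 * M + 2\<rbrakk> \<Longrightarrow> t i j = t i (2 * M + 3 + i - j)"
    and degree: "i \<in> {1..2 * M + 2} \<Longrightarrow>
      (\<Sum>k\<in>{1..<i}. weight (t k i)) + (\<Sum>j\<in>{i<..2 * M + 2}. weight (t i j)) = D"
    and even_D: "even D"
begin

definition row_weight :: "nat \<Rightarrow> nat" where
  "row_weight i = (\<Sum>j\<in>{i<..2 * M + 2}. weight (t i j))"

text \<open>Halving turns row weights modulo 4 into sums modulo 2, which are linear in
  \<open>t\<close>.\<close>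

definition half_weight :: "nat \<Rightarrow> nat" where
  "half_weight i = (\<Sum>p\<in>{1..(2 * M + 2 - i) div 2}. weight (t i (i + p)))"

text \<open>The reflection turns column \<open>i\<close> into row
  \<open>2 * M + 3 - i\<close>.\<close>

lemma row_weight_sum:
  assumes "i \<in> {1..2 * M + 2}"
  shows "row_weight i + row_weight (2 * M + 3 - i) = D"
proof -
  have "(\<Sum>k\<in>{1..<i}. weight (t k i)) = row_weight (2 * M + 3 - i)"
    unfolding row_weight_def
  proof (rule sum.reindex_bij_witness[of _ "\<lambda>k. 2 * M + 3 - k" "\<lambda>k. 2 * M + 3 - k"])
    show "weight (t (2 * M + 3 - i) (2 * M + 3 - k)) = weight (t k i)" if "k \<in> {1..<i}" for k
      using reflect[of k i] that assms by simp
  qed (use assms in auto)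
  then show ?thesis
    using degree[OF assms] by (simp add: row_weight_def)
qed

lemma row_weight_eq:
  assumes "i \<in> {1..2 * M + 2}"
  shows "row_weight i = 2 * half_weight i
    + (if odd i then weight (t i (i + (2 * M + 2 - i) div 2 + 1)) else 0)"
proof -
  let ?n = "2 * M + 2 - i"
  have "row_weight i = (\<Sum>p\<in>{1..?n}. weight (t i (i + p)))"
    unfolding row_weight_def
    by (rule sum.reindex_bij_witness[of _ "\<lambda>p. i + p" "\<lambda>j. j - i"]) auto
  also have "\<dots> = 2 * (\<Sum>p\<in>{1..?n div 2}. weight (t i (i + p)))
      + (if odd ?n then weight (t i (i + (?n div 2 + 1))) else 0)"
  proof (rule sum_palindrome)
    fix p assume p: "p \<in> {1..?n}"
    have "t i (i + p) = t i (2 * M + 3 + i - (i + p))"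
      using assms p by (intro palindrome) auto
    moreover have "2 * M + 3 + i - (i + p) = i + (?n + 1 - p)"
      using assms p by auto
    ultimately show "weight (t i (i + (?n + 1 - p))) = weight (t i (i + p))"
      by simp
  qed
  also have "odd ?n \<longleftrightarrow> odd i"
    using assms by auto
  finally show ?thesis
    by (simp add: half_weight_def add.assoc)
qed

text \<open>The last row is empty, so row 1 alone has the even weight \<open>D\<close>; a palindrome
  of odd length has the parity of its middle.\<close>

lemma top_middle: "t 1 (M + 2) = 0"
proof -
  have "row_weight (2 * M + 2) = 0"
    by (simp add: row_weight_def)
  then have "row_weight 1 = D"
    using row_weight_sum[of 1] by simp
  then have "even (weight (t 1 (M + 2)))"
    using row_weight_eq[of 1] even_D by simp
  then show ?thesis
    by (cases "t 1 (M + 2)") auto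
qed

lemma odd_row_middle:
  assumes "odd i" "1 \<le> i" "i \<le> 2 * M + 1"
  shows "t i (M + 1 + (i + 1) div 2) = 0"
proof (cases "i = 1")
  case True
  then show ?thesis using top_middle by simp
next
  case False
  then obtain l where i: "i = Suc (2 * l)" "1 \<le> l"
    using assms(1,2) by (auto elim!: oddE)
  have "t (Suc (2 * l)) (M + 2 + l) = t (2 * l) (M + 2 + l - 1) + t (2 * l) (M + 2 + l)"
    using assms i by (intro rule) auto
  moreover have "t (2 * l) (M + 2 + l) = t (2 * l) (2 * M + 3 + 2 * l - (M + 2 + l))"
    using assms i by (intro palindrome) auto
  ultimately show ?thesis
    using i by (simp add: add.commute)
qed

lemma row_weight_half:
  assumes "2 \<le> i" "i \<le> 2 * M + 2"
  shows "row_weight i = 2 * half_weight i"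
proof (cases "odd i")
  case True
  then have "i + (2 * M + 2 - i) div 2 + 1 = M + 1 + (i + 1) div 2" "i \<le> 2 * M + 1"
    using assms by (auto elim!: oddE)
  then have "t i (i + (2 * M + 2 - i) div 2 + 1) = 0"
    using odd_row_middle[of i] True assms by simp
  then show ?thesis
    using row_weight_eq[of i] assms by simp
qed (use row_weight_eq[of i] assms in simp)

lemma half_weight_bit:
  assumes "1 \<le> i" "i \<le> 2 * M + 1"
  shows "of_nat (half_weight (Suc i)) = t i (Suc i) + t i (Suc i + (2 * M + 1 - i) div 2)"
proof -
  let ?h = "(2 * M + 1 - i) div 2"
  have "of_nat (half_weight (Suc i)) = (\<Sum>p\<in>{1..?h}. t (Suc i) (Suc i + p))"
    unfolding half_weight_def by (simp only: of_nat_sum of_nat_weight) simp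
  also have "\<dots> = (\<Sum>p\<in>{Suc 0..?h}. t i (Suc i + (p - 1)) + t i (Suc i + p))"
  proof (rule sum.cong)
    fix p assume p: "p \<in> {Suc 0..?h}"
    have "t (Suc i) (Suc i + p) = t i (Suc i + p - 1) + t i (Suc i + p)"
      using assms p by (intro rule) auto
    then show "t (Suc i) (Suc i + p) = t i (Suc i + (p - 1)) + t i (Suc i + p)"
      using p by simp
  qed simp
  also have "\<dots> = t i (Suc i) + t i (Suc i + ?h)"
    using bit_telescope[of 0 ?h "\<lambda>p. t i (Suc i + p)"] by simp
  finally show ?thesis .
qed

text \<open>Rows \<open>k + 1\<close> and \<open>2 * M + 2 - k\<close> together have weight
  \<open>D\<close>. Telescoping their half weights leaves a few entries of the rows above, among
  which \<open>t k (Suc k)\<close> occurs twice, once through the reflection.\<close>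

lemma axis_half_degree:
  assumes "even k" "2 \<le> k" "k \<le> 2 * M"
  shows "t k (M + 1 + k div 2) = t k (k + 2) + of_nat (D div 2)"
proof -
  let ?i = "2 * M + 1 - k"
  have "row_weight (Suc k) = 2 * half_weight (Suc k)" "row_weight (Suc ?i) = 2 * half_weight (Suc ?i)"
    using assms by (intro row_weight_half; simp)+
  moreover have "row_weight (Suc k) + row_weight (2 * M + 3 - Suc k) = D"
    using assms by (intro row_weight_sum) auto
  moreover have "2 * M + 3 - Suc k = Suc ?i"
    using assms by auto
  ultimately have "half_weight (Suc k) + half_weight (Suc ?i) = D div 2"
    by simp
  then have "of_nat (D div 2) = (of_nat (half_weight (Suc k)) + of_nat (half_weight (Suc ?i)) :: bit)"
    by (simp flip: of_nat_add)
  also have "of_nat (half_weight (Suc k)) = t k (Suc k) + t k (M + 1 + k div 2)"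
  proof -
    have "Suc k + (2 * M + 1 - k) div 2 = M + 1 + k div 2"
      using assms by (auto elim!: evenE)
    then show ?thesis
      using half_weight_bit[of k] assms by simp
  qed
  also have "of_nat (half_weight (Suc ?i)) = t ?i (Suc ?i)"
  proof -
    have "Suc ?i + (2 * M + 1 - ?i) div 2 = M + 1 + (?i + 1) div 2"
      using assms by (auto elim!: evenE)
    moreover have "odd ?i"
      using assms by auto
    ultimately show ?thesis
      using half_weight_bit[of ?i] odd_row_middle[of ?i] assms by simp
  qed
  also have "t ?i (Suc ?i) = t (Suc k) (k + 2)"
  proof -
    have "2 * M + 3 - Suc ?i = Suc k" "2 * M + 3 - ?i = k + 2"
      using assms by auto
    then show ?thesis
      using reflect[of ?i "Suc ?i"] assms by simp
  qed
  also have "t (Suc k) (k + 2) = t k (Suc k) + t k (k + 2)"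
    using rule[of k "k + 2"] assms by simp
  finally show ?thesis
    by (simp add: ac_simps)
qed

text \<open>In the row of length 2 the middle and the second entry are the two equal ends of a
  palindrome, so the correction \<open>D div 2\<close> is even.\<close>

lemma four_dvd_D: "4 dvd D"
proof -
  have "t (2 * M) (2 * M + 1) = t (2 * M) (2 * M + 2)"
    using palindrome[of "2 * M" "2 * M + 1"] M_pos by simp
  moreover have "t (2 * M) (M + 1 + 2 * M div 2) = t (2 * M) (2 * M + 2) + of_nat (D div 2)"
    using M_pos by (intro axis_half_degree) auto
  ultimately have "of_nat (D div 2) = (0 :: bit)"
    by (simp add: mult_2)
  then have "even (D div 2)"
    by (simp only: of_nat_bit_eq_0_iff)
  then show ?thesis
    using even_D by (auto elim!: evenE)
qed

sublocale symmetric_triangle M t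
proof
  show "t k (k + 2) = t k (M + 1 + k div 2)" if "even k" "2 \<le> k" "k \<le> 2 * M" for k
    using axis_half_degree[OF that] four_dvd_D by (auto elim!: dvdE)
qed (fact M_pos rule reflect palindrome top_middle)+

end

section \<open>Regular Steinhaus graphs of odd degree\<close>

lemma bit_sum_step:
  fixes x1 x2 X y1 Y z1 Z c :: bit
  assumes "x1 + y1 + z1 = c" "x2 + (Y + y1) + (z1 + Z) = c"
  shows "(x1 + x2) + Y + Z = 0"
proof -
  have "(x1 + x2) + Y + Z = (x1 + y1 + z1) + (x2 + (Y + y1) + (z1 + Z))"
    by (simp add: ac_simps)
  then show ?thesis
    using assms by simp
qed

locale odd_regular_steinhaus =
  fixes n d :: nat and a :: "nat \<Rightarrow> nat \<Rightarrow> bit"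
  assumes n_gt: "2 < n"
    and diagonal: "i \<in> {1..n} \<Longrightarrow> a i i = 0"
    and recurrence: "\<lbrakk>1 \<le> i; Suc i < j; j \<le> n\<rbrakk> \<Longrightarrow> a (Suc i) j = a i (j - 1) + a i j"
    and symmetric: "\<lbrakk>i \<in> {1..n}; j \<in> {1..n}\<rbrakk> \<Longrightarrow> a i j = a j i"
    and degree: "i \<in> {1..n} \<Longrightarrow> (\<Sum>j\<in>{1..n}. weight (a i j)) = d"
    and odd_d: "odd d"
begin

lemma row_sum:
  assumes "i \<in> {1..n}"
  shows "(\<Sum>j\<in>{1..n}. a i j) = 1"
  using degree[OF assms] odd_d even_weight_sum[of "a i" "{1..n}"] by simp

text \<open>The sum over row \<open>i + 1\<close> telescopes up column \<open>i + 2\<close> left of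
  the diagonal and along row \<open>i\<close> right of it.\<close>

lemma row_sum_corners:
  assumes "1 \<le> i" "i + 2 \<le> n"
  shows "a 1 (i + 2) + a i n + a i (i + 2) = 1"
proof -
  have "{1..n} = {1..i} \<union> {Suc i} \<union> {Suc (Suc i)..n}"
    using assms by auto
  then have "(\<Sum>j\<in>{1..n}. a (Suc i) j) =
      (\<Sum>j\<in>{1..i}. a (Suc i) j) + a (Suc i) (Suc i) + (\<Sum>j\<in>{Suc (Suc i)..n}. a (Suc i) j)"
    by (simp only:) (subst sum.union_disjoint; auto)+
  also have "(\<Sum>j\<in>{1..i}. a (Suc i) j) = (\<Sum>j\<in>{Suc 1..Suc i}. a (j - 1) (i + 2) + a j (i + 2))"
  proof (rule sum.reindex_bij_witness[of _ "\<lambda>j. j - 1" Suc])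
    show "a (Suc j - 1) (i + 2) + a (Suc j) (i + 2) = a (Suc i) j" if "j \<in> {1..i}" for j
      using recurrence[of j "i + 2"] symmetric[of j "Suc i"] that assms by (simp add: ac_simps)
  qed auto
  also have "\<dots> = a 1 (i + 2) + a (Suc i) (i + 2)"
    using bit_telescope[of 1 "Suc i" "\<lambda>j. a j (i + 2)"] by simp
  also have "(\<Sum>j\<in>{Suc (Suc i)..n}. a (Suc i) j) = (\<Sum>j\<in>{Suc (Suc i)..n}. a i (j - 1) + a i j)"
    using assms by (intro sum.cong recurrence) auto
  also have "\<dots> = a i (Suc i) + a i n"
    using bit_telescope[of "Suc i" n "a i"] assms by simp
  finally show ?thesis
    using row_sum[of "Suc i"] recurrence[of i "i + 2"] diagonal[of "Suc i"] assms
    by (simp add: ac_simps)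
qed

text \<open>Adding the instances for \<open>k\<close> and \<open>Suc k\<close> gives the next
  \<open>s\<close>; the right-hand sides cancel.\<close>

lemma corner_identity:
  "1 \<le> k \<Longrightarrow> k + s + 2 \<le> n \<Longrightarrow>
    a (s + 1) (k + s + 2) + a k (n - s) + a k (k + s + 2) = of_bool (s = 0)"
proof (induction s arbitrary: k)
  case 0
  then show ?case using row_sum_corners[of k] by simp
next
  case (Suc s)
  have e1: "a (s + 1) (k + s + 2) + a k (n - s) + a k (k + s + 2) = of_bool (s = 0)"
    and e2: "a (s + 1) (Suc k + s + 2) + a (Suc k) (n - s) + a (Suc k) (Suc k + s + 2) = of_bool (s = 0)"
    using Suc.prems by (intro Suc.IH; simp)+
  have r1: "a (Suc (s + 1)) (Suc k + s + 2) = a (s + 1) (Suc k + s + 2 - 1) + a (s + 1) (Suc k + s + 2)"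
    and r2: "a (Suc k) (n - s) = a k (n - s - 1) + a k (n - s)"
    and r3: "a (Suc k) (Suc k + s + 2) = a k (Suc k + s + 2 - 1) + a k (Suc k + s + 2)"
    using Suc.prems by (intro recurrence; simp)+
  have "a (s + 1) (k + s + 2) + a (s + 1) (Suc k + s + 2) + a k (n - s - 1) + a k (Suc k + s + 2) = 0"
    using e2 unfolding r2 r3 by (intro bit_sum_step[OF e1]) simp
  then show ?case
    using r1 by simp
qed

text \<open>For \<open>s = k - 1\<close> the first and third terms of \<open>corner_identity\<close>
  coincide.\<close>

lemma antidiagonal:
  assumes "1 \<le> k" "2 * k < n"
  shows "a k (n + 1 - k) = of_bool (k = 1)"
proof -
  have "a (k - 1 + 1) (k + (k - 1) + 2) + a k (n - (k - 1)) + a k (k + (k - 1) + 2) = of_bool (k - 1 = 0)"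
    using assms by (intro corner_identity) auto
  moreover have "n - (k - 1) = n + 1 - k" "k - 1 + 1 = k"
    using assms by auto
  ultimately show ?thesis
    using assms by (auto simp: ac_simps split: if_splits)
qed

lemma corner: "a 1 n = 1"
  using antidiagonal[of 1] n_gt by simp

text \<open>Induction on the distance \<open>m\<close> from the antidiagonal: entries on it are
  fixed, and its zeros settle \<open>m = 1\<close>.\<close>

lemma reflect_aux:
  "i + j + m = n + 1 \<Longrightarrow> 2 \<le> i \<Longrightarrow> i < j \<Longrightarrow> j < n \<Longrightarrow> a i j = a (n + 1 - j) (n + 1 - i)"
proof (induction m arbitrary: i j rule: less_induct)
  case (less m)
  consider "m = 0" | "m = 1" | "2 \<le> m"
    by linarith
  then show ?case
  proof cases
    case 1
    then have "n + 1 - j = i" "n + 1 - i = j" using less.prems by auto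
    then show ?thesis by simp
  next
    case 2
    then have j: "j = n - i" and i: "2 * i < n" using less.prems by auto
    have "a (Suc i) (n + 1 - i) = a i (n + 1 - i - 1) + a i (n + 1 - i)"
      using less.prems 2 by (intro recurrence) auto
    moreover have "a i (n + 1 - i) = 0"
      using antidiagonal[of i] less.prems(2) i by simp
    moreover have "n + 1 - j = Suc i" "n + 1 - i - 1 = j"
      using less.prems 2 by auto
    ultimately show ?thesis by simp
  next
    case 3
    have "a (Suc i) (Suc j) = a (n + 1 - Suc j) (n + 1 - Suc i)"
      using less.prems 3 by (intro less.IH[of "m - 2"]) auto
    moreover have "a i (Suc j) = a (n + 1 - Suc j) (n + 1 - i)"
      using less.prems 3 by (intro less.IH[of "m - 1"]) auto
    moreover have "a (Suc i) (Suc j) = a i (Suc j - 1) + a i (Suc j)"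
      using less.prems 3 by (intro recurrence) auto
    then have "a i j = a (Suc i) (Suc j) + a i (Suc j)"
      by (simp add: add.assoc)
    moreover have "a (Suc (n - j)) (n + 1 - i) = a (n - j) (n + 1 - i - 1) + a (n - j) (n + 1 - i)"
      using less.prems 3 by (intro recurrence) auto
    moreover have "n + 1 - j = Suc (n - j)" "n + 1 - i - 1 = n - i"
      using less.prems by auto
    ultimately show ?thesis
      by simp
  qed
qed

lemma inner_reflect:
  assumes "2 \<le> i" "i < j" "j < n"
  shows "a i j = a (n + 1 - j) (n + 1 - i)"
proof (cases "i + j \<le> n + 1")
  case True
  then show ?thesis
    using reflect_aux[of i j "n + 1 - (i + j)"] assms by simp
next
  case False
  have "a (n + 1 - j) (n + 1 - i) = a (n + 1 - (n + 1 - i)) (n + 1 - (n + 1 - j))"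
    using reflect_aux[of "n + 1 - j" "n + 1 - i" "i + j - (n + 1)"] False assms by auto
  then show ?thesis
    using assms by simp
qed

lemma inner_reflect_all:
  assumes "i \<in> {2..<n}" "j \<in> {2..<n}"
  shows "a i j = a (n + 1 - i) (n + 1 - j)"
proof -
  consider "i < j" | "i = j" | "j < i" by linarith
  then show ?thesis
  proof cases
    case 1
    have "a (n + 1 - j) (n + 1 - i) = a (n + 1 - i) (n + 1 - j)"
      using assms by (intro symmetric) auto
    then show ?thesis
      using inner_reflect[of i j] 1 assms by auto
  next
    case 2
    have "a i i = 0" "a (n + 1 - i) (n + 1 - i) = 0"
      using assms by (intro diagonal; auto)+
    then show ?thesis
      using 2 by simp
  next
    case 3
    then show ?thesis
      using inner_reflect[of j i] symmetric[of i j] assms by auto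
  qed
qed

text \<open>Reflection turns the increments along the last column into entries of row 2, which
  telescope in row 1; the summand 1 is the corner.\<close>

lemma last_column_aux: "m + 3 \<le> n \<Longrightarrow> a (m + 2) n = a 1 (n - 1 - m) + 1"
proof (induction m)
  case 0
  then show ?case
    using recurrence[of 1 n] corner by (simp add: numeral_2_eq_2)
next
  case (Suc m)
  have "a (Suc (m + 2)) n = a (m + 2) (n - 1) + a (m + 2) n"
    using Suc.prems by (intro recurrence) auto
  moreover have "a (m + 2) (n - 1) = a (n + 1 - (n - 1)) (n + 1 - (m + 2))"
    using Suc.prems by (intro inner_reflect) auto
  moreover have "n + 1 - (n - 1) = 2" "n + 1 - (m + 2) = n - 1 - m"
    using Suc.prems by auto
  moreover have "a 2 (n - 1 - m) = a 1 (n - 1 - m - 1) + a 1 (n - 1 - m)"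
    using recurrence[of 1 "n - 1 - m"] Suc.prems by (simp add: numeral_2_eq_2)
  ultimately show ?case
    using Suc by (simp add: ac_simps)
qed

lemma last_column:
  assumes "2 \<le> i" "i < n"
  shows "a i n = a 1 (n + 1 - i) + 1"
proof -
  have "i - 2 + 2 = i" "n - 1 - (i - 2) = n + 1 - i"
    using assms by auto
  then show ?thesis
    using last_column_aux[of "i - 2"] assms by simp
qed

lemma sum_split_ends: "(\<Sum>j\<in>{1..n}. f j) = f 1 + (\<Sum>j\<in>{2..<n}. f j) + f n" for f :: "nat \<Rightarrow> nat"
proof -
  have "{1..n} = {1} \<union> {2..<n} \<union> {n}"
    using n_gt by auto
  then show ?thesis
    using n_gt by (simp only:) (subst sum.union_disjoint; auto)+
qed

text \<open>Opposite vertices have equal inner weights by reflection, so equal degrees force equal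
  contributions from the two outer columns.\<close>

lemma first_row_palindrome:
  assumes "2 \<le> i" "i < n"
  shows "a 1 i = a 1 (n + 1 - i)"
proof -
  let ?i = "n + 1 - i"
  have "(\<Sum>j\<in>{2..<n}. weight (a i j)) = (\<Sum>j\<in>{2..<n}. weight (a ?i j))"
  proof (rule sum.reindex_bij_witness[of _ "\<lambda>j. n + 1 - j" "\<lambda>j. n + 1 - j"])
    show "weight (a ?i (n + 1 - j)) = weight (a i j)" if "j \<in> {2..<n}" for j
      using inner_reflect_all[of i j] that assms by simp
  qed (use assms in auto)
  moreover have "(\<Sum>j\<in>{1..n}. weight (a i j)) = (\<Sum>j\<in>{1..n}. weight (a ?i j))"
  proof -
    have "i \<in> {1..n}" "?i \<in> {1..n}"
      using assms by auto
    then show ?thesis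
      by (simp only: degree)
  qed
  ultimately have "weight (a i 1) + weight (a i n) = weight (a ?i 1) + weight (a ?i n)"
    by (simp only: sum_split_ends)
  moreover have "a i 1 = a 1 i" "a ?i 1 = a 1 ?i"
    using assms by (intro symmetric; auto)+
  moreover have "a i n = a 1 ?i + 1" "a ?i n = a 1 i + 1"
    using last_column[of i] last_column[of ?i] assms by auto
  ultimately show ?thesis
    by (cases "a 1 i"; cases "a 1 ?i") auto
qed

lemma inner_degree:
  assumes "2 \<le> i" "i < n"
  shows "(\<Sum>j\<in>{2..<n}. weight (a i j)) = d - 1"
proof -
  have "a i 1 = a 1 i"
    using assms by (intro symmetric) auto
  moreover have "a i n = a 1 i + 1"
    using last_column[of i] first_row_palindrome[of i] assms by simp
  ultimately have "weight (a i 1) + weight (a i n) = 1"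
    by (cases "a 1 i") auto
  then show ?thesis
    using degree[of i] assms by (simp only: sum_split_ends) auto
qed

text \<open>The inner parts of the first and last rows are complementary, so these two degrees sum
  to \<open>n - 2\<close> plus 2 for the corners.\<close>

lemma n_eq: "n = 2 * d"
proof -
  have "a n 1 = 1"
    using corner symmetric[of 1 n] n_gt by simp
  then have "d = 1 + (\<Sum>j\<in>{2..<n}. weight (a n j))"
    using degree[of n] diagonal[of n] n_gt unfolding sum_split_ends by simp
  also have "(\<Sum>j\<in>{2..<n}. weight (a n j)) = (\<Sum>j\<in>{2..<n}. weight (a 1 j + 1))"
  proof (rule sum.cong)
    fix j assume "j \<in> {2..<n}"
    then show "weight (a n j) = weight (a 1 j + 1)"
      using symmetric[of n j] last_column[of j] first_row_palindrome[of j] by simp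
  qed simp
  finally have "d = 1 + (\<Sum>j\<in>{2..<n}. weight (a 1 j + 1))" .
  moreover have "d = (\<Sum>j\<in>{2..<n}. weight (a 1 j)) + 1"
    using degree[of 1] diagonal[of 1] n_gt corner unfolding sum_split_ends by simp
  moreover have "(\<Sum>j\<in>{2..<n}. weight (a 1 j)) + (\<Sum>j\<in>{2..<n}. weight (a 1 j + 1)) = (\<Sum>j\<in>{2..<n}. 1)"
    unfolding sum.distrib[symmetric]
  proof (rule sum.cong)
    show "weight (a 1 j) + weight (a 1 j + 1) = 1" for j
      by (cases "a 1 j") auto
  qed simp
  ultimately show ?thesis
    using n_gt by simp
qed

lemma d_ge_3: "3 \<le> d"
  using n_gt n_eq odd_d by (cases "d = 2") auto

lemma row_palindrome:
  "1 \<le> i \<Longrightarrow> i < j \<Longrightarrow> j < n \<Longrightarrow> a i j = a i (n + i - j)"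
proof (induction i arbitrary: j rule: dec_induct)
  case base
  then show ?case
    using first_row_palindrome[of j] by simp
next
  case (step i)
  have "a (Suc i) j = a i (j - 1) + a i j"
    using step.prems step.hyps by (intro recurrence) auto
  moreover have "a (Suc i) (n + Suc i - j) = a i (n + Suc i - j - 1) + a i (n + Suc i - j)"
    using step.prems step.hyps by (intro recurrence) auto
  moreover have "a i j = a i (n + i - j)" "a i (j - 1) = a i (n + i - (j - 1))"
    using step.prems step.hyps by (intro step.IH; simp)+
  moreover have "n + i - (j - 1) = n + Suc i - j" "n + Suc i - j - 1 = n + i - j"
    using step.prems by auto
  ultimately show ?case
    by (simp add: add.commute)
qed

sublocale multisymmetric "d - 2" "d - 1" "\<lambda>i j. a (Suc i) (Suc j)"
proof
  have size: "2 * (d - 2) + 2 = n - 2" "2 * (d - 2) + 3 = n - 1"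
    using n_eq d_ge_3 by auto
  show "1 \<le> d - 2" using d_ge_3 by simp
  show "even (d - 1)" using odd_d by simp
  fix i j :: nat
  show "a (Suc (Suc i)) (Suc j) = a (Suc i) (Suc (j - 1)) + a (Suc i) (Suc j)"
    if "1 \<le> i" "Suc i < j" "j \<le> 2 * (d - 2) + 2"
    using that recurrence[of "Suc i" "Suc j"] n_gt unfolding size by simp
  show "a (Suc i) (Suc j) = a (Suc (2 * (d - 2) + 3 - j)) (Suc (2 * (d - 2) + 3 - i))"
    if "1 \<le> i" "i < j" "j \<le> 2 * (d - 2) + 2"
    using that inner_reflect[of "Suc i" "Suc j"] n_gt unfolding size by (simp add: Suc_diff_Suc)
  show "a (Suc i) (Suc j) = a (Suc i) (Suc (2 * (d - 2) + 3 + i - j))"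
    if "1 \<le> i" "i < j" "j \<le> 2 * (d - 2) + 2"
  proof -
    have "n + Suc i - Suc j = Suc (n - 1 + i - j)"
      using that n_gt unfolding size by auto
    then show ?thesis
      using that row_palindrome[of "Suc i" "Suc j"] n_gt unfolding size by simp
  qed
  show "(\<Sum>k\<in>{1..<i}. weight (a (Suc k) (Suc i))) + (\<Sum>j\<in>{i<..2 * (d - 2) + 2}. weight (a (Suc i) (Suc j))) = d - 1"
    if i: "i \<in> {1..2 * (d - 2) + 2}"
  proof -
    have "d - 1 = (\<Sum>j\<in>{2..<n}. weight (a (Suc i) j))"
      using i n_gt unfolding size by (intro inner_degree[symmetric]) auto
    also have "\<dots> = (\<Sum>j\<in>{1..n - 2}. weight (a (Suc i) (Suc j)))"
      by (rule sum.reindex_bij_witness[of _ Suc "\<lambda>j. j - 1"]) auto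
    also have "{1..n - 2} = {1..<i} \<union> {i} \<union> {i<..n - 2}"
      using i unfolding size by auto
    also have "(\<Sum>j\<in>\<dots>. weight (a (Suc i) (Suc j))) = (\<Sum>j\<in>{1..<i}. weight (a (Suc i) (Suc j)))
        + weight (a (Suc i) (Suc i)) + (\<Sum>j\<in>{i<..n - 2}. weight (a (Suc i) (Suc j)))"
      by (subst sum.union_disjoint; auto)+
    also have "(\<Sum>j\<in>{1..<i}. weight (a (Suc i) (Suc j))) = (\<Sum>j\<in>{1..<i}. weight (a (Suc j) (Suc i)))"
    proof (rule sum.cong)
      show "weight (a (Suc i) (Suc j)) = weight (a (Suc j) (Suc i))" if "j \<in> {1..<i}" for j
        using that i symmetric[of "Suc i" "Suc j"] n_gt unfolding size by simp
    qed simp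
    also have "a (Suc i) (Suc i) = 0"
      using i n_gt unfolding size by (intro diagonal) auto
    finally show ?thesis
      unfolding size by simp
  qed
qed

end

context odd_regular_steinhaus
begin

lemma n_large: "1500 < n"
proof (rule ccontr)
  assume "\<not> 1500 < n"
  then have "d \<le> 750"
    using n_eq by simp
  obtain c where c: "d - 1 = 4 * c"
    using four_dvd_D by (elim dvdE)
  have "(d - 2) mod 4 = 3" "d - 2 \<le> 747"
  proof -
    \<comment> \<open>Divisibility by 4 sharpens \<open>d \<le> 750\<close> to
      \<open>d \<le> 749\<close>.\<close>
    have "d - 2 = 3 + 4 * (c - 1)" "c \<le> 187"
      using c d_ge_3 \<open>d \<le> 750\<close> by linarith+
    then show "(d - 2) mod 4 = 3" "d - 2 \<le> 747"
      by simp_all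
  qed
  note zero = zero_upto_747[OF this]
  have top: "a 2 (Suc j) = 0" if "2 \<le> j" "j \<le> 2 * (d - 2) + 2" for j
  proof -
    have "a (Suc 1) (Suc j) = 0"
      by (rule top_row_zero[OF zero that])
    then show ?thesis
      by (simp only: Suc_1)
  qed
  \<comment> \<open>With row 2 zero, the recurrence makes row 1 constant between the diagonal and
    the corner.\<close>
  have const: "a 1 j = a 1 2" if "2 \<le> j" "j < n" for j
    using that
  proof (induction j rule: dec_induct)
    case (step j)
    have "a 2 (Suc j) = a 1 j + a 1 (Suc j)"
      using recurrence[of 1 "Suc j"] step.hyps step.prems by (simp add: numeral_2_eq_2)
    moreover have "a 2 (Suc j) = 0"
      using top[of j] step.hyps step.prems n_eq by simp
    ultimately have "a 1 j + a 1 (Suc j) = 0"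
      by simp
    then have "a 1 (Suc j) = a 1 j"
      by (simp only: bit_add_eq_0_iff)
    then show ?case
      using step.IH step.prems by simp
  qed simp
  have "d = (\<Sum>j\<in>{2..<n}. weight (a 1 j)) + 1"
    using degree[of 1] diagonal[of 1] n_gt corner unfolding sum_split_ends by simp
  also have "(\<Sum>j\<in>{2..<n}. weight (a 1 j)) = (\<Sum>j\<in>{2..<n}. weight (a 1 2))"
  proof (rule sum.cong)
    show "weight (a 1 j) = weight (a 1 2)" if "j \<in> {2..<n}" for j
      using const[of j] that by (simp only: atLeastLessThan_iff)
  qed simp
  \<comment> \<open>Constant 0 gives \<open>d = 1\<close>; constant 1 gives
    \<open>d = n - 1 = 2 * d - 1\<close>, again \<open>d = 1\<close>.\<close>
  finally show False
    using n_eq d_ge_3 by (cases "a 1 2") auto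
qed

end

section \<open>From graphs to matrices\<close>

lemma out_degree_eq:
  assumes "steinhaus_graph n G" "v \<in> {1..n}"
  shows "out_degree (with_proj G) v = (\<Sum>j\<in>{1..n}. weight (adjacency_matrix G v j))"
proof -
  interpret pair_graph G
    using assms(1) by (simp add: steinhaus_graph_def)
  have "out_arcs (with_proj G) v = Pair v ` {j \<in> {1..n}. (v, j) \<in> parcs G}"
    using assms(1) in_arcsD2 by (auto simp: out_arcs_def steinhaus_graph_def)
  then have "out_degree (with_proj G) v = card {j \<in> {1..n}. (v, j) \<in> parcs G}"
    unfolding out_degree_def by (simp add: card_image inj_on_def)
  also have "\<dots> = (\<Sum>j\<in>{1..n}. weight (adjacency_matrix G v j))"
    by (auto simp: adjacency_matrix_def intro!: arg_cong[where f = card])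
  finally show ?thesis .
qed

theorem theorem9:
  fixes n :: nat
  assumes "2 < n" and "n \<le> 1500"
  shows "\<not> (\<exists>G d. steinhaus_graph n G \<and> regular_of_degree G d \<and> odd d)"
proof
  assume "\<exists>G d. steinhaus_graph n G \<and> regular_of_degree G d \<and> odd d"
  then obtain G d where G: "steinhaus_graph n G" "regular_of_degree G d" "odd d"
    by blast
  let ?a = "adjacency_matrix G"
  have "odd_regular_steinhaus n d ?a"
  proof
    fix i j :: nat
    have mat: "steinhaus_matrix n ?a"
      using G(1) by (simp add: steinhaus_graph_def)
    show "?a i i = 0" if "i \<in> {1..n}"
      using mat that by (simp add: steinhaus_matrix_def)
    show "?a (Suc i) j = ?a i (j - 1) + ?a i j" if "1 \<le> i" "Suc i < j" "j \<le> n"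
    proof -
      have "2 \<le> Suc i \<and> Suc i < j \<and> j \<le> n \<longrightarrow> ?a (Suc i) j = ?a (Suc i - 1) (j - 1) + ?a (Suc i - 1) j"
        using mat unfolding steinhaus_matrix_def by blast
      then show ?thesis
        using that by simp
    qed
    show "?a i j = ?a j i" if "i \<in> {1..n}" "j \<in> {1..n}"
      using mat that unfolding steinhaus_matrix_def by blast
    show "(\<Sum>j\<in>{1..n}. weight (?a i j)) = d" if "i \<in> {1..n}"
      using out_degree_eq[OF G(1) that] G(1,2) that
      by (simp add: regular_of_degree_def steinhaus_graph_def)
  qed (fact assms(1) G(3))+
  then show False
    using odd_regular_steinhaus.n_large assms(2) by fastforce
qed

end
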